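(* Let $\Gamma\vdash\psi:A$ be a well-typed formula of the higher-order fixpoint arithmetic, and let $\rho\in[\![\Gamma]\!]$ and $\eta\in[\![\mathrm{tr}(\Gamma)]\!]_M$. If $\rho\,\mathcal{R}_\Gamma\,\eta$, then $[\![\Gamma\vdash\psi:A]\!](\rho)\;\mathcal{R}_A\;[\![\mathrm{tr}(\Gamma)\vdash\mathrm{tr}(\psi):\mathrm{tr}(A)]\!]_M(\eta)$.
   Context: Higher-order fixpoint arithmetic: types $A::=N\mid T$, $T::=\mathbf{Prop}\mid A\to T$. Formulas: $s::=X\mid Z\mid S\,s$; $\psi::=s\mid s_1\le s_2\mid\psi_1\land\psi_2\mid\psi_1\lor\psi_2\mid\lambda X.\psi\mid\psi_1\psi_2\mid\mu X.\psi\mid\nu X.\psi$, simply typed with $Z:N$, $S:N\to N$, $\le$ on $N$ giving $\mathbf{Prop}$, $\land,\lor$ on $\mathbf{Prop}$, and $\mu X.\psi,\nu X.\psi:T$ when $\Gamma,X:T\vdash\psi:T$ ($T$ not $N$). Semantics: $[\![N]\!]=\mathbb{N}$ (discrete order), $[\![\mathbf{Prop}]\!]=\{0,1\}$ with $0\le1$, $[\![A\to T]\!]=$ monotone functions, pointwise order; $Z=0$, $S$ is successor, $s\le t$ is $1$ iff the value of $s$ is $\le$ that of $t$; $\land$ is min, $\lor$ is max; $\mu,\nu$ least/greatest fixpoints; $\lambda$, application as usual. $[\![\Gamma]\!]$ is the set of environments $\rho$ with $\rho(X)\in[\![\Gamma(X)]\!]$. PHFL (over a Markov chain): formulas $\varphi::=p\mid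 X\mid\varphi_1\lor\varphi_2\mid\varphi_1\land\varphi_2\mid[\varphi]_J\mid\Box\varphi\mid\Diamond\varphi\mid\bigcirc\varphi\mid\mu X.\varphi\mid\nu X.\varphi\mid\lambda X.\varphi\mid\varphi_1\varphi_2$, types $\mathbf{Prop}$ and $\tau_1\to\tau_2$; $[\![\mathbf{Prop}]\!]_M=[0,1]^S$, higher types monotone functions, pointwise orders; $[\![p]\!](s)=1$ iff $s\in L(p)$ else $0$; $\land,\lor$ pointwise min/max; $[\![[\varphi]_{\ge r}]\!](s)=1$ iff $[\![\varphi]\!](s)\ge r$, else $0$; $[\![\bigcirc\varphi]\!](s)=\sum_{s'}P(s,s')[\![\varphi]\!](s')$; $\mu,\nu$ least/greatest fixpoints. The Markov chain $M$ has states $s_0,s_0',s_1,s_1'$, with $P(s_0,s_1)=P(s_0,s_0')=P(s_0',s_0)=P(s_0',s_1')=\tfrac12$, $P(s_1,s_0)=P(s_1',s_0')=1$, all other probabilities $0$; atomic propositions $p_0,p_0',p_1,p_1'$ with $L(p_0)=\{s_0\}$, $L(p_0')=\{s_0'\}$, $L(p_1)=\{s_1\}$, $L(p_1')=\{s_1'\}$; initial state $s_0$. Elements of $[\![\mathbf{Prop}]\!]_M$ are written $(v(s_0),v(s_0'),v(s_1),v(s_1'))$. Translation: $\mathrm{tr}(N)=\mathrm{tr}(\mathbf{Prop})=\mathbf{Prop}$, $\mathrm{tr}(A\to T)=\mathrm{tr}(A)\to\mathrm{tr}(T)$, extended pointwise to environments; $\mathrm{tr}(Z)=p_0$; $\mathrm{tr}(S\,s)=\bigcirc((\bigcirc\mathrm{tr}(s)\land(p_1\lor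 p_1'))\lor p_0)$; $\mathrm{tr}(s\le t)=[\bigcirc((\bigcirc\mathrm{tr}(s)\land p_1)\lor(\mathrm{tr}(t)\land p_0'))]_{\ge1/2}$; $\mathrm{tr}$ commutes with $X,\land,\lor,\lambda$, application, $\mu,\nu$. Relations $\mathcal{R}_A\subseteq[\![A]\!]\times[\![\mathrm{tr}(A)]\!]_M$: $n\,\mathcal{R}_N\,(r_0,r_0',r_1,r_1')$ iff $r_0=2^{-n}$ and $r_0'=1-2^{-n}$; $b\,\mathcal{R}_{\mathbf{Prop}}\,(r_0,r_0',r_1,r_1')$ iff $b=r_0$; $f\,\mathcal{R}_{A\to T}\,g$ iff $x\,\mathcal{R}_A\,y$ implies $f\,x\,\mathcal{R}_T\,g\,y$. $\rho\,\mathcal{R}_\Gamma\,\eta$ iff $\rho(X)\,\mathcal{R}_{\Gamma(X)}\,\eta(X)$ for every $X\in\mathrm{dom}(\Gamma)$. *)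

theory Defs
  imports Complex_Main
begin

section \<open>Simple types and the full monotone type hierarchy\<close>

datatype 'i sty = Ground 'i | Arr "'i sty" "'i sty"  (infixr \<open>\<rightarrowtail>\<close> 60)

primrec height :: "'i sty \<Rightarrow> nat" where
  "height (Ground i) = 0"
| "height (A \<rightarrowtail> T) = Suc (max (height A) (height T))"

text \<open>
  A value is an element of a ground domain or a code of a function.  The map
  \<open>graph F\<close> decodes a code to the function it stands for, a partial function on values whose
  domain is exactly the domain of the argument type.

  Codes are needed because HOL has no single type containing the interpretations of all simple
  types at once: the hierarchy over an infinite ground domain reaches cardinality
  \<open>beth_n\<close> for every \<open>n\<close>.  For every height bound, however, there is a type of
  codes that represents the full hierarchy up to this bound; see \<open>full_0\<close> and
  \<open>full_Suc\<close> below.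
\<close>

datatype ('b, 'c) val = Gnd (gnd: 'b) | Code (code: 'c)

record ('i, 'b, 'c) frame =
  gcar :: "'i \<Rightarrow> 'b set"
  gle :: "'i \<Rightarrow> 'b \<Rightarrow> 'b \<Rightarrow> bool"
  graph :: "'c \<Rightarrow> (('b, 'c) val \<rightharpoonup> ('b, 'c) val)"

definition mono_maps ::
  "'v set \<Rightarrow> ('v \<Rightarrow> 'v \<Rightarrow> bool) \<Rightarrow> 'v set \<Rightarrow> ('v \<Rightarrow> 'v \<Rightarrow> bool) \<Rightarrow> ('v \<rightharpoonup> 'v) set" where
  "mono_maps X leX Y leY =
     {f. dom f = X \<and> ran f \<subseteq> Y \<and>
         (\<forall>x\<in>X. \<forall>x'\<in>X. leX x x' \<longrightarrow> leY (the (f x)) (the (f x')))}"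

definition app :: "('i, 'b, 'c) frame \<Rightarrow> ('b, 'c) val \<Rightarrow> ('b, 'c) val \<Rightarrow> ('b, 'c) val" where
  "app F v x = the (graph F (code v) x)"

text \<open>\<open>D F A\<close> is the domain interpreting the type \<open>A\<close>, and \<open>le F A\<close> is its order.\<close>

fun D :: "('i, 'b, 'c) frame \<Rightarrow> 'i sty \<Rightarrow> ('b, 'c) val set"
and le :: "('i, 'b, 'c) frame \<Rightarrow> 'i sty \<Rightarrow> ('b, 'c) val \<Rightarrow> ('b, 'c) val \<Rightarrow> bool" where
  "D F (Ground i) = Gnd ` gcar F i"
| "D F (A \<rightarrowtail> T) = Code ` {c. graph F c \<in> mono_maps (D F A) (le F A) (D F T) (le F T)}"
| "le F (Ground i) = (\<lambda>v w. gle F i (gnd v) (gnd w))"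
| "le F (A \<rightarrowtail> T) = (\<lambda>v w. \<forall>x\<in>D F A. le F T (app F v x) (app F w x))"

text \<open>
  If \<open>full k F\<close>, then for every type \<open>A \<rightarrowtail> T\<close> of height at most
  \<open>k\<close>, the elements of \<open>D F (A \<rightarrowtail> T)\<close> are in bijection, via
  \<open>graph F\<close>, with all monotone functions from \<open>D F A\<close> to \<open>D F T\<close>.
\<close>

definition full :: "nat \<Rightarrow> ('i, 'b, 'c) frame \<Rightarrow> bool" where
  "full k F \<longleftrightarrow> inj (graph F) \<and>
     (\<forall>A T. height (A \<rightarrowtail> T) \<le> k \<longrightarrow>
        mono_maps (D F A) (le F A) (D F T) (le F T) \<subseteq> range (graph F))"

definition full_for :: "('i, 'b, 'c) frame \<Rightarrow> 'i sty set \<Rightarrow> bool" where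
  "full_for F \<A> \<longleftrightarrow> (\<exists>k. full k F \<and> (\<forall>A\<in>\<A>. height A \<le> k))"

lemma full_0: "full 0 \<lparr>gcar = car, gle = l, graph = (\<lambda>_::unit. Map.empty)\<rparr>"
  by (auto simp: full_def inj_def)

lemma full_Suc:
  fixes g :: "'c \<Rightarrow> (('b, 'c) val \<rightharpoonup> ('b, 'c) val)"
  assumes full: "full k \<lparr>gcar = car, gle = l, graph = g\<rparr>"
  shows "\<exists>g' :: (('b, 'c) val \<rightharpoonup> ('b, 'c) val) \<Rightarrow>
             (('b, ('b, 'c) val \<rightharpoonup> ('b, 'c) val) val \<rightharpoonup> ('b, ('b, 'c) val \<rightharpoonup> ('b, 'c) val) val).
           full (Suc k) \<lparr>gcar = car, gle = l, graph = g'\<rparr>"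
proof -
  define F where "F = \<lparr>gcar = car, gle = l, graph = g\<rparr>"
  define e :: "('b, 'c) val \<Rightarrow> ('b, ('b, 'c) val \<rightharpoonup> ('b, 'c) val) val"
    where "e v = (case v of Gnd b \<Rightarrow> Gnd b | Code c \<Rightarrow> Code (g c))" for v
  define g' :: "(('b, 'c) val \<rightharpoonup> ('b, 'c) val) \<Rightarrow>
      (('b, ('b, 'c) val \<rightharpoonup> ('b, 'c) val) val \<rightharpoonup> ('b, ('b, 'c) val \<rightharpoonup> ('b, 'c) val) val)"
    where "g' d y = (if y \<in> range e then map_option e (d (inv e y)) else None)" for d y
  define F' where "F' = \<lparr>gcar = car, gle = l, graph = g'\<rparr>"
  have inj_g: "inj g" and rng: "\<And>A T. height (A \<rightarrowtail> T) \<le> k \<Longrightarrow>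
      mono_maps (D F A) (le F A) (D F T) (le F T) \<subseteq> range g"
    using full by (auto simp: full_def F_def)
  have inj_e: "inj e"
    by (rule injI) (auto simp: e_def split: val.splits dest: injD[OF inj_g])
  have g'_e: "g' d (e x) = map_option e (d x)" for d x
    by (simp add: g'_def inj_e)
  have inj_g': "inj g'"
  proof (rule injI)
    fix d d' assume "g' d = g' d'"
    then have "map_option e (d x) = map_option e (d' x)" for x by (simp flip: g'_e)
    then show "d = d'" by (intro ext) (simp add: inj_eq option.inj_map inj_e)
  qed
  have dom_g': "dom (g' d) = e ` dom d" for d
    by (auto simp: g'_def inj_e inj_eq dom_def split: if_splits)
  have ran_g': "ran (g' d) = e ` ran d" for d
  proof
    show "ran (g' d) \<subseteq> e ` ran d"
      by (auto simp: g'_def ran_def split: if_splits)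
    show "e ` ran d \<subseteq> ran (g' d)"
    proof
      fix z assume "z \<in> e ` ran d"
      then obtain x y where "z = e y" "d x = Some y" by (auto simp: ran_def)
      then have "g' d (e x) = Some z" by (simp add: g'_e)
      then show "z \<in> ran (g' d)" by (rule ranI)
    qed
  qed
  have mm: "g' d \<in> mono_maps (e ` X) lx' (e ` Y) ly' \<longleftrightarrow> d \<in> mono_maps X lx Y ly"
    if "\<And>x y. x \<in> X \<Longrightarrow> y \<in> X \<Longrightarrow> lx' (e x) (e y) = lx x y"
      and "\<And>x y. x \<in> Y \<Longrightarrow> y \<in> Y \<Longrightarrow> ly' (e x) (e y) = ly x y"
    for d X Y lx' ly' lx ly
  proof (cases "dom d = X \<and> ran d \<subseteq> Y")
    case True
    then have *: "\<exists>y. d x = Some y \<and> y \<in> Y" if "x \<in> X" for x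
      using that by (auto simp: dom_def ran_def)
    have **: "ly' (the (g' d (e x))) (the (g' d (e y))) = ly (the (d x)) (the (d y))"
      if "x \<in> X" "y \<in> X" for x y
      using *[OF that(1)] *[OF that(2)] \<open>\<And>x y. x \<in> Y \<Longrightarrow> y \<in> Y \<Longrightarrow> ly' (e x) (e y) = ly x y\<close>
      by (auto simp: g'_e)
    have "(\<forall>x\<in>X. \<forall>x'\<in>X. lx' (e x) (e x') \<longrightarrow> ly' (the (g' d (e x))) (the (g' d (e x')))) \<longleftrightarrow>
        (\<forall>x\<in>X. \<forall>x'\<in>X. lx x x' \<longrightarrow> ly (the (d x)) (the (d x')))"
      by (intro ball_cong refl) (simp add: ** that(1))
    then show ?thesis
      using True by (simp add: mono_maps_def dom_g' ran_g' image_mono)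
  next
    case False
    then show ?thesis
      by (auto simp: mono_maps_def dom_g' ran_g' inj_image_eq_iff[OF inj_e]
          inj_image_subset_iff[OF inj_e])
  qed
  have DL: "height A \<le> k \<Longrightarrow> D F' A = e ` D F A \<and>
      (\<forall>x\<in>D F A. \<forall>y\<in>D F A. le F' A (e x) (e y) = le F A x y)" for A
  proof (induction A)
    case (Ground i)
    show ?case by (auto simp: F_def F'_def e_def image_image)
  next
    case (Arr A T)
    then have IH: "D F' A = e ` D F A" "D F' T = e ` D F T"
      "\<And>x y. x \<in> D F A \<Longrightarrow> y \<in> D F A \<Longrightarrow> le F' A (e x) (e y) = le F A x y"
      "\<And>x y. x \<in> D F T \<Longrightarrow> y \<in> D F T \<Longrightarrow> le F' T (e x) (e y) = le F T x y"
      by auto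
    have mm': "g' d \<in> mono_maps (D F' A) (le F' A) (D F' T) (le F' T) \<longleftrightarrow>
        d \<in> mono_maps (D F A) (le F A) (D F T) (le F T)" for d
      unfolding IH(1,2) by (rule mm) (use IH in auto)
    have gF: "graph F = g" "graph F' = g'" by (simp_all add: F_def F'_def)
    have "D F' (A \<rightarrowtail> T) = Code ` mono_maps (D F A) (le F A) (D F T) (le F T)"
      by (simp add: gF mm')
    also have "\<dots> = e ` D F (A \<rightarrowtail> T)"
      using rng[OF Arr.prems] by (force simp: gF e_def)
    finally have 1: "D F' (A \<rightarrowtail> T) = e ` D F (A \<rightarrowtail> T)" .
    have 2: "app F' (e v) (e x) = e (app F v x) \<and> app F v x \<in> D F T"
      if v: "v \<in> D F (A \<rightarrowtail> T)" and x: "x \<in> D F A" for v x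
    proof -
      obtain c where c: "v = Code c" "dom (g c) = D F A" "ran (g c) \<subseteq> D F T"
        using v by (auto simp: gF mono_maps_def)
      then obtain y where "g c x = Some y" "y \<in> D F T"
        using x by (auto simp: dom_def ran_def)
      then show ?thesis using c by (simp add: app_def gF e_def[of "Code c"] g'_e)
    qed
    have "le F' (A \<rightarrowtail> T) (e v) (e w) = le F (A \<rightarrowtail> T) v w"
      if "v \<in> D F (A \<rightarrowtail> T)" "w \<in> D F (A \<rightarrowtail> T)" for v w
      using 2[OF that(1)] 2[OF that(2)] IH(4) by (simp add: IH(1))
    with 1 show ?case by blast
  qed
  have "full (Suc k) F'"
    unfolding full_def
  proof (intro conjI allI impI subsetI)
    show "inj (graph F')" by (simp add: F'_def inj_g')
  next
    fix A T f assume h: "height (A \<rightarrowtail> T) \<le> Suc k"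
      and f: "f \<in> mono_maps (D F' A) (le F' A) (D F' T) (le F' T)"
    from h have "D F' A = e ` D F A" "D F' T = e ` D F T" using DL by auto
    with f have f': "dom f = e ` D F A" "ran f \<subseteq> e ` D F T" by (auto simp: mono_maps_def)
    have "f = g' (\<lambda>x. map_option (inv e) (f (e x)))"
    proof
      fix y
      show "f y = g' (\<lambda>x. map_option (inv e) (f (e x))) y"
      proof (cases "y \<in> range e")
        case True
        then obtain x where x: "y = e x" by blast
        have "f (e x) = map_option e (map_option (inv e) (f (e x)))"
        proof (cases "f (e x)")
          case (Some z)
          then have "z \<in> range e" using f'(2) by (auto simp: ran_def)
          then show ?thesis using Some by (simp add: f_inv_into_f)
        qed simp
        then show ?thesis by (simp add: x g'_e)
      next
        case False
        then have "y \<notin> dom f" using f'(1) by auto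
        then show ?thesis using False by (auto simp: g'_def)
      qed
    qed
    then show "f \<in> range (graph F')" unfolding F'_def by auto
  qed
  then show ?thesis unfolding F'_def by blast
qed

definition lam :: "('i, 'b, 'c) frame \<Rightarrow> 'i sty \<Rightarrow> (('b, 'c) val \<Rightarrow> ('b, 'c) val) \<Rightarrow> ('b, 'c) val" where
  "lam F A f = Code (THE c. graph F c = (\<lambda>x. if x \<in> D F A then Some (f x) else None))"

definition least_fp :: "('i, 'b, 'c) frame \<Rightarrow> 'i sty \<Rightarrow> (('b, 'c) val \<Rightarrow> ('b, 'c) val) \<Rightarrow> ('b, 'c) val" where
  "least_fp F T f = (THE d. d \<in> D F T \<and> f d = d \<and> (\<forall>d'\<in>D F T. f d' = d' \<longrightarrow> le F T d d'))"

definition greatest_fp :: "('i, 'b, 'c) frame \<Rightarrow> 'i sty \<Rightarrow> (('b, 'c) val \<Rightarrow> ('b, 'c) val) \<Rightarrow> ('b, 'c) val" where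
  "greatest_fp F T f = (THE d. d \<in> D F T \<and> f d = d \<and> (\<forall>d'\<in>D F T. f d' = d' \<longrightarrow> le F T d' d))"

type_synonym var = nat
type_synonym 'i ctx = "var \<rightharpoonup> 'i sty"
type_synonym ('b, 'c) env = "var \<rightharpoonup> ('b, 'c) val"

definition envs :: "('i, 'b, 'c) frame \<Rightarrow> 'i ctx \<Rightarrow> ('b, 'c) env set" where
  "envs F \<Gamma> = {\<rho>. dom \<rho> = dom \<Gamma> \<and> (\<forall>X A. \<Gamma> X = Some A \<longrightarrow> the (\<rho> X) \<in> D F A)}"


section \<open>Higher-order fixpoint arithmetic\<close>

datatype hbase = BNat | BProp

abbreviation TNat :: "hbase sty" where "TNat \<equiv> Ground BNat"
abbreviation TProp :: "hbase sty" where "TProp \<equiv> Ground BProp"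

text \<open>
  The grammar \<open>A ::= N | T\<close>, \<open>T ::= Prop | A \<rightarrowtail> T\<close>:
  \<open>is_T\<close> and \<open>is_A\<close> single out the types of the two syntactic categories.
\<close>

fun is_T :: "hbase sty \<Rightarrow> bool" where
  "is_T (Ground b) = (b = BProp)"
| "is_T (A \<rightarrowtail> T) = ((A = TNat \<or> is_T A) \<and> is_T T)"

definition is_A :: "hbase sty \<Rightarrow> bool" where
  "is_A A \<longleftrightarrow> A = TNat \<or> is_T A"

datatype hterm = TmVar var | Zero | Succ hterm

text \<open>Binders carry the type of the bound variable, so that a context and a formula determine
  the typing derivation.\<close>

datatype hfa =
    Tm hterm
  | Leq hterm hterm
  | Conj hfa hfa
  | Disj hfa hfa
  | Lam var "hbase sty" hfa
  | App hfa hfa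
  | Mu var "hbase sty" hfa
  | Nu var "hbase sty" hfa

inductive hterm_typed :: "hbase ctx \<Rightarrow> hterm \<Rightarrow> hbase sty \<Rightarrow> bool" where
  "\<Gamma> X = Some A \<Longrightarrow> hterm_typed \<Gamma> (TmVar X) A"
| "hterm_typed \<Gamma> Zero TNat"
| "hterm_typed \<Gamma> s TNat \<Longrightarrow> hterm_typed \<Gamma> (Succ s) TNat"

inductive hfa_typed :: "hbase ctx \<Rightarrow> hfa \<Rightarrow> hbase sty \<Rightarrow> bool" where
  "hterm_typed \<Gamma> s A \<Longrightarrow> hfa_typed \<Gamma> (Tm s) A"
| "hterm_typed \<Gamma> s TNat \<Longrightarrow> hterm_typed \<Gamma> t TNat \<Longrightarrow> hfa_typed \<Gamma> (Leq s t) TProp"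
| "hfa_typed \<Gamma> a TProp \<Longrightarrow> hfa_typed \<Gamma> b TProp \<Longrightarrow> hfa_typed \<Gamma> (Conj a b) TProp"
| "hfa_typed \<Gamma> a TProp \<Longrightarrow> hfa_typed \<Gamma> b TProp \<Longrightarrow> hfa_typed \<Gamma> (Disj a b) TProp"
| "is_A A \<Longrightarrow> is_T T \<Longrightarrow> hfa_typed (\<Gamma>(X \<mapsto> A)) a T \<Longrightarrow> hfa_typed \<Gamma> (Lam X A a) (A \<rightarrowtail> T)"
| "hfa_typed \<Gamma> a (A \<rightarrowtail> T) \<Longrightarrow> hfa_typed \<Gamma> b A \<Longrightarrow> hfa_typed \<Gamma> (App a b) T"
| "is_T T \<Longrightarrow> hfa_typed (\<Gamma>(X \<mapsto> T)) a T \<Longrightarrow> hfa_typed \<Gamma> (Mu X T a) T"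
| "is_T T \<Longrightarrow> hfa_typed (\<Gamma>(X \<mapsto> T)) a T \<Longrightarrow> hfa_typed \<Gamma> (Nu X T a) T"

text \<open>The types occurring in the derivation for \<open>\<psi>\<close> in the context
  \<open>\<Gamma>\<close>, in contexts or as types of subformulas.\<close>

primrec derivation_types :: "hfa \<Rightarrow> hbase ctx \<Rightarrow> hbase sty set" where
  "derivation_types (Tm s) \<Gamma> = ran \<Gamma> \<union> {A. hfa_typed \<Gamma> (Tm s) A}"
| "derivation_types (Leq s t) \<Gamma> = ran \<Gamma> \<union> {A. hfa_typed \<Gamma> (Leq s t) A}"
| "derivation_types (Conj a b) \<Gamma> =
     {A. hfa_typed \<Gamma> (Conj a b) A} \<union> derivation_types a \<Gamma> \<union> derivation_types b \<Gamma>"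
| "derivation_types (Disj a b) \<Gamma> =
     {A. hfa_typed \<Gamma> (Disj a b) A} \<union> derivation_types a \<Gamma> \<union> derivation_types b \<Gamma>"
| "derivation_types (Lam X A a) \<Gamma> =
     ran \<Gamma> \<union> {B. hfa_typed \<Gamma> (Lam X A a) B} \<union> derivation_types a (\<Gamma>(X \<mapsto> A))"
| "derivation_types (App a b) \<Gamma> =
     {A. hfa_typed \<Gamma> (App a b) A} \<union> derivation_types a \<Gamma> \<union> derivation_types b \<Gamma>"
| "derivation_types (Mu X T a) \<Gamma> =
     ran \<Gamma> \<union> {A. hfa_typed \<Gamma> (Mu X T a) A} \<union> derivation_types a (\<Gamma>(X \<mapsto> T))"
| "derivation_types (Nu X T a) \<Gamma> =
     ran \<Gamma> \<union> {A. hfa_typed \<Gamma> (Nu X T a) A} \<union> derivation_types a (\<Gamma>(X \<mapsto> T))"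

lemma hterm_typed_unique: "hterm_typed \<Gamma> s A \<Longrightarrow> hterm_typed \<Gamma> s B \<Longrightarrow> A = B"
proof (induction rule: hterm_typed.induct)
  case (1 \<Gamma> X A)
  from "1.prems" show ?case by cases (simp add: 1)
next
  case (2 \<Gamma>)
  then show ?case by cases simp
next
  case (3 \<Gamma> s)
  from "3.prems" show ?case by cases simp
qed

inductive_cases hfa_typedE:
  "hfa_typed \<Gamma> (Tm s) B" "hfa_typed \<Gamma> (Leq s t) B" "hfa_typed \<Gamma> (Conj a b) B"
  "hfa_typed \<Gamma> (Disj a b) B" "hfa_typed \<Gamma> (Lam X A a) B" "hfa_typed \<Gamma> (App a b) B"
  "hfa_typed \<Gamma> (Mu X A a) B" "hfa_typed \<Gamma> (Nu X A a) B"

lemma hfa_typed_unique: "hfa_typed \<Gamma> \<psi> A \<Longrightarrow> hfa_typed \<Gamma> \<psi> B \<Longrightarrow> A = B"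
proof (induction arbitrary: B rule: hfa_typed.induct)
  case (1 \<Gamma> s A)
  then show ?case by (blast elim: hfa_typedE dest: hterm_typed_unique)
qed (blast elim: hfa_typedE)+

lemma finite_derivation_types:
  "finite (dom \<Gamma>) \<Longrightarrow> finite (derivation_types \<psi> \<Gamma>)"
proof -
  have fin: "finite {A. hfa_typed \<Gamma>' \<psi>' A}" for \<Gamma>' \<psi>'
  proof (cases "\<exists>A. hfa_typed \<Gamma>' \<psi>' A")
    case True
    then obtain A where "hfa_typed \<Gamma>' \<psi>' A" by blast
    then have "{A. hfa_typed \<Gamma>' \<psi>' A} \<subseteq> {A}" using hfa_typed_unique by blast
    then show ?thesis by (rule finite_subset) simp
  qed simp
  show "finite (dom \<Gamma>) \<Longrightarrow> finite (derivation_types \<psi> \<Gamma>)"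
    by (induction \<psi> arbitrary: \<Gamma>) (simp_all add: fin finite_ran)
qed

text \<open>The domain \<open>{0, 1}\<close> of \<open>Prop\<close> is rendered by \<open>bool\<close>, ordered by
  \<open>False \<le> True\<close>.\<close>

datatype hgnd = Num (num: nat) | Tv (tv: bool)

fun hcar :: "hbase \<Rightarrow> hgnd set" where
  "hcar BNat = range Num"
| "hcar BProp = range Tv"

fun hle :: "hbase \<Rightarrow> hgnd \<Rightarrow> hgnd \<Rightarrow> bool" where
  "hle BNat x y = (x = y)"
| "hle BProp x y = (tv x \<le> tv y)"

definition hfa_frame ::
  "('c \<Rightarrow> ((hgnd, 'c) val \<rightharpoonup> (hgnd, 'c) val)) \<Rightarrow> (hbase, hgnd, 'c) frame" where
  "hfa_frame g = \<lparr>gcar = hcar, gle = hle, graph = g\<rparr>"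

primrec hterm_sem :: "hterm \<Rightarrow> (hgnd, 'c) env \<Rightarrow> (hgnd, 'c) val" where
  "hterm_sem (TmVar X) \<rho> = the (\<rho> X)"
| "hterm_sem Zero \<rho> = Gnd (Num 0)"
| "hterm_sem (Succ s) \<rho> = Gnd (Num (Suc (num (gnd (hterm_sem s \<rho>)))))"

primrec hfa_sem :: "(hbase, hgnd, 'c) frame \<Rightarrow> hfa \<Rightarrow> (hgnd, 'c) env \<Rightarrow> (hgnd, 'c) val" where
  "hfa_sem F (Tm s) \<rho> = hterm_sem s \<rho>"
| "hfa_sem F (Leq s t) \<rho> =
     Gnd (Tv (num (gnd (hterm_sem s \<rho>)) \<le> num (gnd (hterm_sem t \<rho>))))"
| "hfa_sem F (Conj a b) \<rho> = Gnd (Tv (min (tv (gnd (hfa_sem F a \<rho>))) (tv (gnd (hfa_sem F b \<rho>)))))"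
| "hfa_sem F (Disj a b) \<rho> = Gnd (Tv (max (tv (gnd (hfa_sem F a \<rho>))) (tv (gnd (hfa_sem F b \<rho>)))))"
| "hfa_sem F (Lam X A a) \<rho> = lam F A (\<lambda>x. hfa_sem F a (\<rho>(X \<mapsto> x)))"
| "hfa_sem F (App a b) \<rho> = app F (hfa_sem F a \<rho>) (hfa_sem F b \<rho>)"
| "hfa_sem F (Mu X T a) \<rho> = least_fp F T (\<lambda>x. hfa_sem F a (\<rho>(X \<mapsto> x)))"
| "hfa_sem F (Nu X T a) \<rho> = greatest_fp F T (\<lambda>x. hfa_sem F a (\<rho>(X \<mapsto> x)))"


section \<open>PHFL over a finite Markov chain\<close>

record ('s, 'p) markov_chain =
  trans_prob :: "'s \<Rightarrow> 's \<Rightarrow> real"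
  label :: "'p \<Rightarrow> 's set"
  init :: 's

definition is_markov_chain :: "('s::finite, 'p) markov_chain \<Rightarrow> bool" where
  "is_markov_chain M \<longleftrightarrow>
     (\<forall>s s'. 0 \<le> trans_prob M s s') \<and> (\<forall>s. (\<Sum>s'\<in>UNIV. trans_prob M s s') = 1)"

datatype pbase = PProp

datatype threshold = AtLeast real | GreaterThan real

fun meets :: "threshold \<Rightarrow> real \<Rightarrow> bool" where
  "meets (AtLeast r) x = (x \<ge> r)"
| "meets (GreaterThan r) x = (x > r)"

datatype 'p phfl =
    Atom 'p
  | PVar var
  | POr "'p phfl" "'p phfl"
  | PAnd "'p phfl" "'p phfl"
  | Thr "'p phfl" threshold
  | Box "'p phfl"
  | Diamond "'p phfl"
  | Next "'p phfl"
  | PMu var "pbase sty" "'p phfl"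
  | PNu var "pbase sty" "'p phfl"
  | PLam var "pbase sty" "'p phfl"
  | PApp "'p phfl" "'p phfl"

inductive phfl_typed :: "pbase ctx \<Rightarrow> 'p phfl \<Rightarrow> pbase sty \<Rightarrow> bool" where
  "phfl_typed \<Gamma> (Atom p) (Ground PProp)"
| "\<Gamma> X = Some A \<Longrightarrow> phfl_typed \<Gamma> (PVar X) A"
| "phfl_typed \<Gamma> a (Ground PProp) \<Longrightarrow> phfl_typed \<Gamma> b (Ground PProp) \<Longrightarrow>
   phfl_typed \<Gamma> (POr a b) (Ground PProp)"
| "phfl_typed \<Gamma> a (Ground PProp) \<Longrightarrow> phfl_typed \<Gamma> b (Ground PProp) \<Longrightarrow>
   phfl_typed \<Gamma> (PAnd a b) (Ground PProp)"
| "phfl_typed \<Gamma> a (Ground PProp) \<Longrightarrow> phfl_typed \<Gamma> (Thr a J) (Ground PProp)"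
| "phfl_typed \<Gamma> a (Ground PProp) \<Longrightarrow> phfl_typed \<Gamma> (Box a) (Ground PProp)"
| "phfl_typed \<Gamma> a (Ground PProp) \<Longrightarrow> phfl_typed \<Gamma> (Diamond a) (Ground PProp)"
| "phfl_typed \<Gamma> a (Ground PProp) \<Longrightarrow> phfl_typed \<Gamma> (Next a) (Ground PProp)"
| "phfl_typed (\<Gamma>(X \<mapsto> A)) a A \<Longrightarrow> phfl_typed \<Gamma> (PMu X A a) A"
| "phfl_typed (\<Gamma>(X \<mapsto> A)) a A \<Longrightarrow> phfl_typed \<Gamma> (PNu X A a) A"
| "phfl_typed (\<Gamma>(X \<mapsto> A)) a B \<Longrightarrow> phfl_typed \<Gamma> (PLam X A a) (A \<rightarrowtail> B)"
| "phfl_typed \<Gamma> a (A \<rightarrowtail> B) \<Longrightarrow> phfl_typed \<Gamma> b A \<Longrightarrow> phfl_typed \<Gamma> (PApp a b) B"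

definition phfl_frame ::
  "('c \<Rightarrow> (('s \<Rightarrow> real, 'c) val \<rightharpoonup> ('s \<Rightarrow> real, 'c) val)) \<Rightarrow> (pbase, 's \<Rightarrow> real, 'c) frame" where
  "phfl_frame h =
     \<lparr>gcar = (\<lambda>_. {u. \<forall>s. 0 \<le> u s \<and> u s \<le> 1}), gle = (\<lambda>_ u w. \<forall>s. u s \<le> w s), graph = h\<rparr>"

primrec phfl_sem ::
  "('s::finite, 'p) markov_chain \<Rightarrow> (pbase, 's \<Rightarrow> real, 'c) frame \<Rightarrow> 'p phfl \<Rightarrow>
   ('s \<Rightarrow> real, 'c) env \<Rightarrow> ('s \<Rightarrow> real, 'c) val" where
  "phfl_sem M F (Atom p) \<eta> = Gnd (\<lambda>s. if s \<in> label M p then 1 else 0)"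
| "phfl_sem M F (PVar X) \<eta> = the (\<eta> X)"
| "phfl_sem M F (POr a b) \<eta> =
     Gnd (\<lambda>s. max (gnd (phfl_sem M F a \<eta>) s) (gnd (phfl_sem M F b \<eta>) s))"
| "phfl_sem M F (PAnd a b) \<eta> =
     Gnd (\<lambda>s. min (gnd (phfl_sem M F a \<eta>) s) (gnd (phfl_sem M F b \<eta>) s))"
| "phfl_sem M F (Thr a J) \<eta> = Gnd (\<lambda>s. if meets J (gnd (phfl_sem M F a \<eta>) s) then 1 else 0)"
| "phfl_sem M F (Box a) \<eta> =
     Gnd (\<lambda>s. Min (gnd (phfl_sem M F a \<eta>) ` {s'. trans_prob M s s' > 0}))"
| "phfl_sem M F (Diamond a) \<eta> =
     Gnd (\<lambda>s. Max (gnd (phfl_sem M F a \<eta>) ` {s'. trans_prob M s s' > 0}))"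
| "phfl_sem M F (Next a) \<eta> =
     Gnd (\<lambda>s. \<Sum>s'\<in>UNIV. trans_prob M s s' * gnd (phfl_sem M F a \<eta>) s')"
| "phfl_sem M F (PMu X A a) \<eta> = least_fp F A (\<lambda>x. phfl_sem M F a (\<eta>(X \<mapsto> x)))"
| "phfl_sem M F (PNu X A a) \<eta> = greatest_fp F A (\<lambda>x. phfl_sem M F a (\<eta>(X \<mapsto> x)))"
| "phfl_sem M F (PLam X A a) \<eta> = lam F A (\<lambda>x. phfl_sem M F a (\<eta>(X \<mapsto> x)))"
| "phfl_sem M F (PApp a b) \<eta> = app F (phfl_sem M F a \<eta>) (phfl_sem M F b \<eta>)"


section \<open>The Markov chain, the translation and the relations\<close>

datatype state = s0 | s0' | s1 | s1'
datatype atom = p0 | p0' | p1 | p1'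

lemma UNIV_state: "UNIV = {s0, s0', s1, s1'}"
  using state.exhaust by blast

instance state :: finite
  by standard (simp add: UNIV_state)

fun M_prob :: "state \<Rightarrow> state \<Rightarrow> real" where
  "M_prob s0 s1 = 1/2"
| "M_prob s0 s0' = 1/2"
| "M_prob s0' s0 = 1/2"
| "M_prob s0' s1' = 1/2"
| "M_prob s1 s0 = 1"
| "M_prob s1' s0' = 1"
| "M_prob _ _ = 0"

fun M_label :: "atom \<Rightarrow> state set" where
  "M_label p0 = {s0}"
| "M_label p0' = {s0'}"
| "M_label p1 = {s1}"
| "M_label p1' = {s1'}"

definition M :: "(state, atom) markov_chain" where
  "M = \<lparr>trans_prob = M_prob, label = M_label, init = s0\<rparr>"

lemma is_markov_chain_M: "is_markov_chain M"
proof -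
  have "0 \<le> M_prob s s'" for s s' by (cases s; cases s') auto
  moreover have "(\<Sum>s'\<in>UNIV. M_prob s s') = 1" for s
    by (cases s) (auto simp: UNIV_state)
  ultimately show ?thesis by (simp add: is_markov_chain_def M_def)
qed

primrec tr_ty :: "hbase sty \<Rightarrow> pbase sty" where
  "tr_ty (Ground b) = Ground PProp"
| "tr_ty (A \<rightarrowtail> T) = tr_ty A \<rightarrowtail> tr_ty T"

definition tr_ctx :: "hbase ctx \<Rightarrow> pbase ctx" where
  "tr_ctx \<Gamma> = map_option tr_ty \<circ> \<Gamma>"

primrec tr_term :: "hterm \<Rightarrow> atom phfl" where
  "tr_term (TmVar X) = PVar X"
| "tr_term Zero = Atom p0"
| "tr_term (Succ s) =
     Next (POr (PAnd (Next (tr_term s)) (POr (Atom p1) (Atom p1'))) (Atom p0))"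

primrec tr :: "hfa \<Rightarrow> atom phfl" where
  "tr (Tm s) = tr_term s"
| "tr (Leq s t) =
     Thr (Next (POr (PAnd (Next (tr_term s)) (Atom p1)) (PAnd (tr_term t) (Atom p0'))))
       (AtLeast (1/2))"
| "tr (Conj a b) = PAnd (tr a) (tr b)"
| "tr (Disj a b) = POr (tr a) (tr b)"
| "tr (Lam X A a) = PLam X (tr_ty A) (tr a)"
| "tr (App a b) = PApp (tr a) (tr b)"
| "tr (Mu X T a) = PMu X (tr_ty T) (tr a)"
| "tr (Nu X T a) = PNu X (tr_ty T) (tr a)"

lemma tr_ctx_upd: "tr_ctx (\<Gamma>(X \<mapsto> A)) = (tr_ctx \<Gamma>)(X \<mapsto> tr_ty A)"
  by (auto simp: tr_ctx_def)

lemma tr_term_typed: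
  "hterm_typed \<Gamma> s A \<Longrightarrow> phfl_typed (tr_ctx \<Gamma>) (tr_term s) (tr_ty A)"
  by (induction rule: hterm_typed.induct) (auto simp: tr_ctx_def intro!: phfl_typed.intros)

lemma tr_typed: "hfa_typed \<Gamma> \<psi> A \<Longrightarrow> phfl_typed (tr_ctx \<Gamma>) (tr \<psi>) (tr_ty A)"
proof (induction rule: hfa_typed.induct)
  case (1 \<Gamma> s A)
  then show ?case by (simp add: tr_term_typed)
next
  case (2 \<Gamma> s t)
  then show ?case using tr_term_typed[of \<Gamma> s TNat] tr_term_typed[of \<Gamma> t TNat]
    by (auto intro!: phfl_typed.intros)
qed (simp_all add: tr_ctx_upd phfl_typed.intros del: fun_upd_apply)

lemma height_tr_ty: "height (tr_ty A) = height A"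
  by (induction A) auto

primrec rel ::
  "(hbase, hgnd, 'c) frame \<Rightarrow> (pbase, state \<Rightarrow> real, 'd) frame \<Rightarrow> hbase sty \<Rightarrow>
   (hgnd, 'c) val \<Rightarrow> (state \<Rightarrow> real, 'd) val \<Rightarrow> bool" where
  "rel F G (Ground b) x y \<longleftrightarrow>
     x \<in> D F (Ground b) \<and> y \<in> D G (tr_ty (Ground b)) \<and>
     (case b of
        BNat \<Rightarrow> gnd y s0 = (1/2) ^ num (gnd x) \<and> gnd y s0' = 1 - (1/2) ^ num (gnd x)
      | BProp \<Rightarrow> of_bool (tv (gnd x)) = gnd y s0)"
| "rel F G (A \<rightarrowtail> T) f g \<longleftrightarrow>
     f \<in> D F (A \<rightarrowtail> T) \<and> g \<in> D G (tr_ty (A \<rightarrowtail> T)) \<and>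
     (\<forall>x\<in>D F A. \<forall>y\<in>D G (tr_ty A). rel F G A x y \<longrightarrow> rel F G T (app F f x) (app G g y))"

definition rel_env ::
  "(hbase, hgnd, 'c) frame \<Rightarrow> (pbase, state \<Rightarrow> real, 'd) frame \<Rightarrow> hbase ctx \<Rightarrow>
   (hgnd, 'c) env \<Rightarrow> (state \<Rightarrow> real, 'd) env \<Rightarrow> bool" where
  "rel_env F G \<Gamma> \<rho> \<eta> \<longleftrightarrow> (\<forall>X A. \<Gamma> X = Some A \<longrightarrow> rel F G A (the (\<rho> X)) (the (\<eta> X)))"

end

theory Submission
  imports Defs
begin

text \<open>
  The formula is handled by induction, as for any logical relation; the point is that least and
  greatest fixpoints preserve the relation at the types of category \<open>T\<close>.  There the relation is
  closed under suprema and infima of sets of related pairs: at \<open>Prop\<close> it only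
  constrains the value at \<open>s0\<close>, and suprema at higher types are pointwise.
  Greatest fixpoints are least fixpoints in the frame with all ground orders reversed, which has the
  same domains, applications and relations.
\<close>

section \<open>Frames with partially ordered ground domains\<close>

text \<open>Maps in the hierarchy are monotone but not necessarily continuous, so finite iteration
  need not reach a fixpoint. This is why closure is needed under suprema of arbitrary sets, not only
  of chains. The type \<open>TNat\<close> is discrete and has no such suprema; it carries no
  fixpoints and enters completeness arguments only as an argument type.

  A second obstacle is that functions are codes: a map becomes an element of a domain only if it is
  monotone and its type lies within the height up to which the frame is full. Hence both semantics
  are first shown to be well defined and monotone, with heights controlled through
  \<open>derivation_types\<close>.

  The two constrained entries of a number have a common origin. PHFL connectives are monotone and
  cannot subtract, so the complement \<open>1 - (1/2) ^ n\<close> is stored at \<open>s0'\<close>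
  next to \<open>(1/2) ^ n\<close> at \<open>s0\<close>. Then \<open>m \<le> n\<close> becomes the
  condition that \<open>(1/2) ^ m + (1 - (1/2) ^ n)\<close> is at least 1, which is monotone in both
  stored entries.\<close>

locale po_frame =
  fixes F :: "('i, 'b, 'c) frame" and k :: nat
  assumes gle_refl: "x \<in> gcar F i \<Longrightarrow> gle F i x x"
    and gle_trans: "x \<in> gcar F i \<Longrightarrow> y \<in> gcar F i \<Longrightarrow> z \<in> gcar F i \<Longrightarrow>
      gle F i x y \<Longrightarrow> gle F i y z \<Longrightarrow> gle F i x z"
    and gle_antisym: "x \<in> gcar F i \<Longrightarrow> y \<in> gcar F i \<Longrightarrow> gle F i x y \<Longrightarrow> gle F i y x \<Longrightarrow> x = y"
    and full: "full k F"

section \<open>Order reversal\<close>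

definition dual :: "('i, 'b, 'c) frame \<Rightarrow> ('i, 'b, 'c) frame" where
  "dual F = F\<lparr>gle := \<lambda>i x y. gle F i y x\<rparr>"

lemma graph_dual [simp]: "graph (dual F) = graph F"
  by (simp add: dual_def)

lemma app_dual [simp]: "app (dual F) = app F"
  by (intro ext) (simp add: app_def)

lemma dual_dual [simp]: "dual (dual F) = F"
  by (simp add: dual_def)

text \<open>A map monotone for two orders is monotone for their converses, so the sets of codes
  coincide. Domains and orders share one induction because the domain at a function type refers to
  the orders of its components.\<close>

lemma D_dual_le_dual: "D (dual F) A = D F A \<and> le (dual F) A = (\<lambda>x y. le F A y x)"
proof (induction A)
  case (Ground i)
  show ?case by (simp add: dual_def)
next
  case (Arr A T)
  then show ?case by (auto simp: mono_maps_def)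
qed

lemma D_dual [simp]: "D (dual F) A = D F A"
  and le_dual [simp]: "le (dual F) A x y = le F A y x"
  using D_dual_le_dual[of F A] by simp_all

lemma full_dual: "full k F \<Longrightarrow> full k (dual F)"
proof -
  have "mono_maps (D F A) (le (dual F) A) (D F T) (le (dual F) T) =
      mono_maps (D F A) (le F A) (D F T) (le F T)" for A T
    unfolding mono_maps_def by auto
  then show "full k F \<Longrightarrow> full k (dual F)" by (simp add: full_def)
qed

lemma app_in: "v \<in> D F (A \<rightarrowtail> T) \<Longrightarrow> x \<in> D F A \<Longrightarrow> app F v x \<in> D F T"
  by (force simp: app_def mono_maps_def dom_def ran_def)

lemma app_mono:
  "v \<in> D F (A \<rightarrowtail> T) \<Longrightarrow> x \<in> D F A \<Longrightarrow> y \<in> D F A \<Longrightarrow> le F A x y \<Longrightarrow>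
    le F T (app F v x) (app F v y)"
  by (auto simp: app_def mono_maps_def)

section \<open>Suprema and completeness\<close>

definition is_lub ::
  "('i, 'b, 'c) frame \<Rightarrow> 'i sty \<Rightarrow> ('b, 'c) val set \<Rightarrow> ('b, 'c) val \<Rightarrow> bool" where
  "is_lub F T S u \<longleftrightarrow> u \<in> D F T \<and> (\<forall>x\<in>S. le F T x u) \<and>
     (\<forall>v\<in>D F T. (\<forall>x\<in>S. le F T x v) \<longrightarrow> le F T u v)"

definition complete_type :: "('i, 'b, 'c) frame \<Rightarrow> 'i sty \<Rightarrow> bool" where
  "complete_type F T \<longleftrightarrow> (\<forall>S\<subseteq>D F T. \<exists>u. is_lub F T S u)"

lemma is_lub_least:
  "is_lub F T S u \<Longrightarrow> v \<in> D F T \<Longrightarrow> (\<And>x. x \<in> S \<Longrightarrow> le F T x v) \<Longrightarrow> le F T u v"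
  by (simp add: is_lub_def)

text \<open>An infimum of \<open>S\<close> is the supremum of the set of its lower bounds, so asking
  for suprema alone also covers the reversed order.\<close>

lemma complete_type_dual:
  assumes "complete_type F T"
  shows "complete_type (dual F) T"
  unfolding complete_type_def
proof (intro allI impI)
  fix S assume S: "S \<subseteq> D (dual F) T"
  define L where "L = {x \<in> D F T. \<forall>y\<in>S. le F T x y}"
  have "L \<subseteq> D F T" by (auto simp: L_def)
  with assms obtain u where "is_lub F T L u" by (auto simp: complete_type_def)
  then have "is_lub (dual F) T S u"
    using S by (auto simp: is_lub_def L_def)
  then show "\<exists>u. is_lub (dual F) T S u" ..
qed

text \<open>Membership and monotonicity are bundled because neither can be established alone: an
  abstraction lies in its domain only if its body is monotone in the bound variable, and the
  fixpoint operators are under control only for monotone bodies. The argument \<open>e\<close> is an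
  arbitrary function of environments, so that both semantics are instances.\<close>

definition mono_sem ::
  "('i, 'b, 'c) frame \<Rightarrow> 'i ctx \<Rightarrow> 'i sty \<Rightarrow> (('b, 'c) env \<Rightarrow> ('b, 'c) val) \<Rightarrow> bool" where
  "mono_sem F \<Gamma> T e \<longleftrightarrow> (\<forall>\<rho>\<in>envs F \<Gamma>. e \<rho> \<in> D F T \<and> (\<forall>\<rho>'\<in>envs F \<Gamma>.
     (\<forall>X A. \<Gamma> X = Some A \<longrightarrow> le F A (the (\<rho> X)) (the (\<rho>' X))) \<longrightarrow> le F T (e \<rho>) (e \<rho>')))"

lemma mono_sem_in: "mono_sem F \<Gamma> T e \<Longrightarrow> \<rho> \<in> envs F \<Gamma> \<Longrightarrow> e \<rho> \<in> D F T"
  by (simp add: mono_sem_def)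

lemma mono_sem_le:
  "mono_sem F \<Gamma> T e \<Longrightarrow> \<rho> \<in> envs F \<Gamma> \<Longrightarrow> \<rho>' \<in> envs F \<Gamma> \<Longrightarrow>
    (\<And>X A. \<Gamma> X = Some A \<Longrightarrow> le F A (the (\<rho> X)) (the (\<rho>' X))) \<Longrightarrow> le F T (e \<rho>) (e \<rho>')"
  by (simp add: mono_sem_def)

lemma mono_semI:
  assumes "\<And>\<rho>. \<rho> \<in> envs F \<Gamma> \<Longrightarrow> e \<rho> \<in> D F T"
    and "\<And>\<rho> \<rho>'. \<rho> \<in> envs F \<Gamma> \<Longrightarrow> \<rho>' \<in> envs F \<Gamma> \<Longrightarrow>
      (\<And>X A. \<Gamma> X = Some A \<Longrightarrow> le F A (the (\<rho> X)) (the (\<rho>' X))) \<Longrightarrow> le F T (e \<rho>) (e \<rho>')"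
  shows "mono_sem F \<Gamma> T e"
  using assms unfolding mono_sem_def by blast

lemma envs_dual [simp]: "envs (dual F) \<Gamma> = envs F \<Gamma>"
  by (simp add: envs_def)

lemma mono_sem_dual: "mono_sem F \<Gamma> T e \<Longrightarrow> mono_sem (dual F) \<Gamma> T e"
  unfolding mono_sem_def by auto

lemma envs_upd: "\<rho> \<in> envs F \<Gamma> \<Longrightarrow> x \<in> D F A \<Longrightarrow> \<rho>(X \<mapsto> x) \<in> envs F (\<Gamma>(X \<mapsto> A))"
  by (auto simp: envs_def)

lemma greatest_fp_dual: "greatest_fp F T f = least_fp (dual F) T f"
  by (simp add: greatest_fp_def least_fp_def)

section \<open>Consequences of the order laws and of fullness\<close>

context po_frame
begin

lemma po_frame_dual: "po_frame (dual F) k"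
proof
  fix i x y z
  show "x \<in> gcar (dual F) i \<Longrightarrow> gle (dual F) i x x"
    by (simp add: dual_def gle_refl)
  show "x \<in> gcar (dual F) i \<Longrightarrow> y \<in> gcar (dual F) i \<Longrightarrow> z \<in> gcar (dual F) i \<Longrightarrow>
      gle (dual F) i x y \<Longrightarrow> gle (dual F) i y z \<Longrightarrow> gle (dual F) i x z"
    using gle_trans[of z i y x] by (simp add: dual_def)
  show "x \<in> gcar (dual F) i \<Longrightarrow> y \<in> gcar (dual F) i \<Longrightarrow>
      gle (dual F) i x y \<Longrightarrow> gle (dual F) i y x \<Longrightarrow> x = y"
    using gle_antisym[of x i y] by (simp add: dual_def)
qed (rule full_dual[OF full])

lemma le_refl: "x \<in> D F A \<Longrightarrow> le F A x x"
proof (induction A arbitrary: x)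
  case (Ground i)
  then show ?case by (auto simp: gle_refl)
next
  case (Arr A T)
  then show ?case using app_in[OF Arr.prems] by simp
qed

lemma le_trans:
  "x \<in> D F A \<Longrightarrow> y \<in> D F A \<Longrightarrow> z \<in> D F A \<Longrightarrow> le F A x y \<Longrightarrow> le F A y z \<Longrightarrow> le F A x z"
proof (induction A arbitrary: x y z)
  case (Ground i)
  then show ?case using gle_trans[of "gnd x" i "gnd y" "gnd z"] by auto
next
  case (Arr A T)
  have "le F T (app F x w) (app F z w)" if "w \<in> D F A" for w
    by (rule Arr.IH(2)[OF Arr.prems(1-3)[THEN app_in[OF _ that]]]) (use Arr.prems(4,5) that in simp_all)
  then show ?case by simp
qed

text \<open>Extensionality: a decoded graph is undefined outside the argument domain and decoding is
  injective, so a code carries no information beyond its applications.\<close>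

lemma arr_eqI:
  assumes v: "v \<in> D F (A \<rightarrowtail> T)" and w: "w \<in> D F (A \<rightarrowtail> T)"
    and eq: "\<And>x. x \<in> D F A \<Longrightarrow> app F v x = app F w x"
  shows "v = w"
proof -
  obtain c d where cd: "v = Code c" "w = Code d" "dom (graph F c) = D F A" "dom (graph F d) = D F A"
    using v w by (auto simp: mono_maps_def)
  have "graph F c x = graph F d x" for x
  proof (cases "x \<in> D F A")
    case True
    then obtain y z where "graph F c x = Some y" "graph F d x = Some z"
      using cd(3,4) by blast
    then show ?thesis using eq[OF True] by (simp add: app_def cd)
  next
    case False
    then show ?thesis using cd(3,4) by (metis domIff)
  qed
  then have "graph F c = graph F d" by blast
  then show ?thesis using full by (auto simp: full_def cd dest: injD)
qed

lemma le_antisym: "x \<in> D F A \<Longrightarrow> y \<in> D F A \<Longrightarrow> le F A x y \<Longrightarrow> le F A y x \<Longrightarrow> x = y"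
proof (induction A arbitrary: x y)
  case (Ground i)
  then show ?case using gle_antisym[of "gnd x" i "gnd y"] by auto
next
  case (Arr A T)
  show ?case
  proof (rule arr_eqI[OF Arr.prems(1,2)])
    fix w assume "w \<in> D F A"
    then show "app F x w = app F y w"
      by (intro Arr.IH(2) app_in[OF Arr.prems(1)] app_in[OF Arr.prems(2)])
        (use Arr.prems(3,4) in simp_all)
  qed
qed

text \<open>Here the height bound enters: fullness supplies a code for the restricted monotone map,
  and injectivity of decoding makes the definite description in \<open>lam\<close> pick this
  code.\<close>

lemma lam:
  assumes k: "height (A \<rightarrowtail> T) \<le> k" and f: "\<And>x. x \<in> D F A \<Longrightarrow> f x \<in> D F T"
    and mono: "\<And>x y. x \<in> D F A \<Longrightarrow> y \<in> D F A \<Longrightarrow> le F A x y \<Longrightarrow> le F T (f x) (f y)"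
  shows lam_in: "lam F A f \<in> D F (A \<rightarrowtail> T)"
    and app_lam: "x \<in> D F A \<Longrightarrow> app F (lam F A f) x = f x"
proof -
  define m where "m = (\<lambda>x. if x \<in> D F A then Some (f x) else None)"
  have m: "m \<in> mono_maps (D F A) (le F A) (D F T) (le F T)"
    using f mono by (auto simp: m_def mono_maps_def dom_def ran_def split: if_splits)
  then have "m \<in> range (graph F)" using full k unfolding full_def by blast
  then obtain c where c: "graph F c = m" by auto
  have "(THE d. graph F d = m) = c"
    using full c by (auto simp: full_def dest: injD)
  then have "lam F A f = Code c" by (simp add: lam_def m_def)
  with c m show "lam F A f \<in> D F (A \<rightarrowtail> T)"
    "x \<in> D F A \<Longrightarrow> app F (lam F A f) x = f x"
    by (auto simp: app_def m_def)
qed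

lemma lub_unique: "is_lub F T S u \<Longrightarrow> is_lub F T S v \<Longrightarrow> u = v"
  by (rule le_antisym[of _ T]) (auto simp: is_lub_def)

text \<open>The suprema chosen for each argument form a monotone map, which fullness turns into an
  element. The pointwise description is recorded along with existence; uniqueness of suprema then
  extends it to every supremum at a function type.\<close>

lemma lub_arr_exists:
  assumes k: "height (A \<rightarrowtail> T) \<le> k" and T: "complete_type F T" and S: "S \<subseteq> D F (A \<rightarrowtail> T)"
  shows "\<exists>u. is_lub F (A \<rightarrowtail> T) S u \<and> (\<forall>x\<in>D F A. is_lub F T ((\<lambda>f. app F f x) ` S) (app F u x))"
proof -
  have "\<exists>u. is_lub F T ((\<lambda>f. app F f x) ` S) u" if "x \<in> D F A" for x
  proof -
    have "(\<lambda>f. app F f x) ` S \<subseteq> D F T" using S that by (auto intro: app_in simp del: D.simps)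
    then show ?thesis using T by (simp add: complete_type_def)
  qed
  then have "\<forall>x\<in>D F A. \<exists>u. is_lub F T ((\<lambda>f. app F f x) ` S) u" by blast
  then obtain s where "\<forall>x\<in>D F A. is_lub F T ((\<lambda>f. app F f x) ` S) (s x)"
    by (rule bchoice[THEN exE])
  then have s: "is_lub F T ((\<lambda>f. app F f x) ` S) (s x)" if "x \<in> D F A" for x
    using that by blast
  have s_in: "s x \<in> D F T" if "x \<in> D F A" for x
    using s[OF that] by (simp add: is_lub_def)
  have s_mono: "le F T (s x) (s y)" if xy: "x \<in> D F A" "y \<in> D F A" "le F A x y" for x y
  proof -
    \<comment> \<open>Each member of \<open>S\<close> is itself monotone, so its value at
      \<open>x\<close> is below its value at \<open>y\<close>, hence below the supremum at
      \<open>y\<close>.\<close>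
    have "le F T (app F f x) (s y)" if "f \<in> S" for f
    proof -
      have "f \<in> D F (A \<rightarrowtail> T)" using S that by auto
      moreover have "le F T (app F f y) (s y)" using s[OF xy(2)] that by (simp add: is_lub_def)
      ultimately show ?thesis
        by (meson le_trans app_in app_mono s_in xy)
    qed
    then show ?thesis using s[OF xy(1)] s_in[OF xy(2)] by (simp add: is_lub_def)
  qed
  note u = lam_in[OF k s_in s_mono] app_lam[OF k s_in s_mono]
  have "is_lub F (A \<rightarrowtail> T) S (lam F A s)"
    using u s by (auto simp: is_lub_def app_in simp del: D.simps)
  then show ?thesis using u(2) s by (intro exI[of _ "lam F A s"]) simp
qed

text \<open>Completeness is inherited from the result type, so function types with argument type
  \<open>TNat\<close> are covered as well.\<close>

lemma complete_type_arr:
  "height (A \<rightarrowtail> T) \<le> k \<Longrightarrow> complete_type F T \<Longrightarrow> complete_type F (A \<rightarrowtail> T)"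
  using lub_arr_exists[of A T] unfolding complete_type_def[of F "A \<rightarrowtail> T"] by blast

lemma lub_arr_app:
  assumes "height (A \<rightarrowtail> T) \<le> k" and "complete_type F T" and "S \<subseteq> D F (A \<rightarrowtail> T)"
    and "is_lub F (A \<rightarrowtail> T) S u" and "x \<in> D F A"
  shows "is_lub F T ((\<lambda>f. app F f x) ` S) (app F u x)"
  using lub_arr_exists[OF assms(1-3)] lub_unique assms(4,5) by blast

text \<open>The Knaster-Tarski theorem. Completeness provides suprema, so the infimum of the
  pre-fixpoints is taken as the supremum of the set \<open>L\<close> of their lower bounds. The last
  conclusion gives minimality among all pre-fixpoints, whereas \<open>least_fp\<close> is defined by
  minimality among fixpoints.\<close>

lemma least_fp:
  assumes T: "complete_type F T"
    and f: "\<And>x. x \<in> D F T \<Longrightarrow> f x \<in> D F T"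
    and mono: "\<And>x y. x \<in> D F T \<Longrightarrow> y \<in> D F T \<Longrightarrow> le F T x y \<Longrightarrow> le F T (f x) (f y)"
  shows least_fp_in: "least_fp F T f \<in> D F T"
    and least_fp_fixed: "f (least_fp F T f) = least_fp F T f"
    and least_fp_least: "y \<in> D F T \<Longrightarrow> le F T (f y) y \<Longrightarrow> le F T (least_fp F T f) y"
proof -
  define L where "L = {x \<in> D F T. \<forall>y\<in>D F T. le F T (f y) y \<longrightarrow> le F T x y}"
  have "L \<subseteq> D F T" by (auto simp: L_def)
  with T obtain u where u: "is_lub F T L u" by (auto simp: complete_type_def)
  have uD: "u \<in> D F T" using u by (simp add: is_lub_def)
  have least: "le F T u y" if "y \<in> D F T" "le F T (f y) y" for y
    using u that by (auto simp: is_lub_def L_def)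
  have "le F T (f u) y" if "y \<in> D F T" "le F T (f y) y" for y
    by (rule le_trans[OF f[OF uD] f[OF that(1)] that(1) mono[OF uD that(1) least[OF that]] that(2)])
  then have "f u \<in> L" using f uD by (simp add: L_def)
  then have 1: "le F T (f u) u" using u by (simp add: is_lub_def)
  \<comment> \<open>By monotonicity \<open>f u\<close> is a pre-fixpoint too, so \<open>u\<close>
    lies below it.\<close>
  then have "le F T u (f u)" using f uD mono least by blast
  with 1 have fixed: "f u = u" using le_antisym f uD by blast
  have "least_fp F T f = u"
    unfolding least_fp_def
  proof (rule the_equality)
    show "u \<in> D F T \<and> f u = u \<and> (\<forall>d'\<in>D F T. f d' = d' \<longrightarrow> le F T u d')"
      using uD fixed least le_refl by auto
    fix d assume d: "d \<in> D F T \<and> f d = d \<and> (\<forall>d'\<in>D F T. f d' = d' \<longrightarrow> le F T d d')"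
    then show "d = u" using uD fixed least le_refl by (auto intro!: le_antisym)
  qed
  then show "least_fp F T f \<in> D F T" "f (least_fp F T f) = least_fp F T f"
    "y \<in> D F T \<Longrightarrow> le F T (f y) y \<Longrightarrow> le F T (least_fp F T f) y"
    using uD fixed least by auto
qed

section \<open>Binders, application and fixpoints as operations on monotone semantics\<close>

lemma mono_sem_upd_le:
  assumes e: "mono_sem F (\<Gamma>(X \<mapsto> A)) T e" and \<rho>: "\<rho> \<in> envs F \<Gamma>" "\<rho>' \<in> envs F \<Gamma>"
    and le: "\<And>Y B. \<Gamma> Y = Some B \<Longrightarrow> le F B (the (\<rho> Y)) (the (\<rho>' Y))"
    and xy: "x \<in> D F A" "y \<in> D F A" "le F A x y"
  shows "le F T (e (\<rho>(X \<mapsto> x))) (e (\<rho>'(X \<mapsto> y)))"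
  by (rule mono_sem_le[OF e envs_upd[OF \<rho>(1) xy(1)] envs_upd[OF \<rho>(2) xy(2)]])
    (use le xy in \<open>auto split: if_splits\<close>)

lemma env_le_refl: "\<rho> \<in> envs F \<Gamma> \<Longrightarrow> \<Gamma> Y = Some B \<Longrightarrow> le F B (the (\<rho> Y)) (the (\<rho> Y))"
  by (simp add: envs_def le_refl)

lemma mono_sem_upd_in:
  "mono_sem F (\<Gamma>(X \<mapsto> A)) T e \<Longrightarrow> \<rho> \<in> envs F \<Gamma> \<Longrightarrow> x \<in> D F A \<Longrightarrow> e (\<rho>(X \<mapsto> x)) \<in> D F T"
  by (rule mono_sem_in[OF _ envs_upd])

lemma mono_sem_upd_mono:
  "mono_sem F (\<Gamma>(X \<mapsto> A)) T e \<Longrightarrow> \<rho> \<in> envs F \<Gamma> \<Longrightarrow> x \<in> D F A \<Longrightarrow> y \<in> D F A \<Longrightarrow> le F A x y \<Longrightarrow>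
    le F T (e (\<rho>(X \<mapsto> x))) (e (\<rho>(X \<mapsto> y)))"
  by (rule mono_sem_upd_le) (auto intro: env_le_refl)

lemma lam_sem:
  assumes "height (A \<rightarrowtail> T) \<le> k" and "mono_sem F (\<Gamma>(X \<mapsto> A)) T e" and "\<rho> \<in> envs F \<Gamma>"
  shows lam_sem_in: "lam F A (\<lambda>x. e (\<rho>(X \<mapsto> x))) \<in> D F (A \<rightarrowtail> T)"
    and app_lam_sem: "x \<in> D F A \<Longrightarrow> app F (lam F A (\<lambda>x. e (\<rho>(X \<mapsto> x)))) x = e (\<rho>(X \<mapsto> x))"
proof -
  let ?f = "\<lambda>x. e (\<rho>(X \<mapsto> x))"
  have f: "?f x \<in> D F T" if "x \<in> D F A" for x
    using mono_sem_upd_in[OF assms(2,3) that] .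
  have mono: "le F T (?f x) (?f y)" if "x \<in> D F A" "y \<in> D F A" "le F A x y" for x y
    using mono_sem_upd_mono[OF assms(2,3) that] .
  show "lam F A ?f \<in> D F (A \<rightarrowtail> T)" by (rule lam_in[OF assms(1) f mono])
  show "x \<in> D F A \<Longrightarrow> app F (lam F A ?f) x = ?f x" by (rule app_lam[OF assms(1) f mono])
qed

lemma mono_sem_lam:
  assumes "height (A \<rightarrowtail> T) \<le> k" and "mono_sem F (\<Gamma>(X \<mapsto> A)) T e"
  shows "mono_sem F \<Gamma> (A \<rightarrowtail> T) (\<lambda>\<rho>. lam F A (\<lambda>x. e (\<rho>(X \<mapsto> x))))"
proof (rule mono_semI)
  fix \<rho> \<rho>' assume "\<rho> \<in> envs F \<Gamma>" "\<rho>' \<in> envs F \<Gamma>"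
    "\<And>Y B. \<Gamma> Y = Some B \<Longrightarrow> le F B (the (\<rho> Y)) (the (\<rho>' Y))"
  then show "le F (A \<rightarrowtail> T) (lam F A (\<lambda>x. e (\<rho>(X \<mapsto> x)))) (lam F A (\<lambda>x. e (\<rho>'(X \<mapsto> x))))"
    using mono_sem_upd_le[OF assms(2)] by (simp add: app_lam_sem[OF assms] le_refl)
qed (rule lam_sem_in[OF assms])

lemma mono_sem_app:
  assumes "mono_sem F \<Gamma> (A \<rightarrowtail> T) d" and "mono_sem F \<Gamma> A e"
  shows "mono_sem F \<Gamma> T (\<lambda>\<rho>. app F (d \<rho>) (e \<rho>))"
proof (rule mono_semI)
  fix \<rho> assume "\<rho> \<in> envs F \<Gamma>"
  then show "app F (d \<rho>) (e \<rho>) \<in> D F T" using assms by (blast intro: app_in mono_sem_in)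
next
  fix \<rho> \<rho>' assume \<rho>: "\<rho> \<in> envs F \<Gamma>" "\<rho>' \<in> envs F \<Gamma>"
    and le: "\<And>Y B. \<Gamma> Y = Some B \<Longrightarrow> le F B (the (\<rho> Y)) (the (\<rho>' Y))"
  note D = \<rho>[THEN mono_sem_in[OF assms(1)]] \<rho>[THEN mono_sem_in[OF assms(2)]]
  have "le F T (app F (d \<rho>) (e \<rho>)) (app F (d \<rho>') (e \<rho>))"
    using mono_sem_le[OF assms(1) \<rho> le] D by simp
  moreover have "le F T (app F (d \<rho>') (e \<rho>)) (app F (d \<rho>') (e \<rho>'))"
    using mono_sem_le[OF assms(2) \<rho> le] D by (blast intro: app_mono)
  ultimately show "le F T (app F (d \<rho>) (e \<rho>)) (app F (d \<rho>') (e \<rho>'))"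
    using D by (blast intro: le_trans app_in)
qed

lemma least_fp_sem:
  assumes "complete_type F T" and "mono_sem F (\<Gamma>(X \<mapsto> T)) T e" and "\<rho> \<in> envs F \<Gamma>"
  shows least_fp_sem_in: "least_fp F T (\<lambda>x. e (\<rho>(X \<mapsto> x))) \<in> D F T"
    and least_fp_sem_fixed:
      "e (\<rho>(X \<mapsto> least_fp F T (\<lambda>x. e (\<rho>(X \<mapsto> x))))) = least_fp F T (\<lambda>x. e (\<rho>(X \<mapsto> x)))"
    and least_fp_sem_least:
      "y \<in> D F T \<Longrightarrow> le F T (e (\<rho>(X \<mapsto> y))) y \<Longrightarrow> le F T (least_fp F T (\<lambda>x. e (\<rho>(X \<mapsto> x)))) y"
proof -
  let ?f = "\<lambda>x. e (\<rho>(X \<mapsto> x))"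
  have f: "?f x \<in> D F T" if "x \<in> D F T" for x
    using mono_sem_upd_in[OF assms(2,3) that] .
  have mono: "le F T (?f x) (?f y)" if "x \<in> D F T" "y \<in> D F T" "le F T x y" for x y
    using mono_sem_upd_mono[OF assms(2,3) that] .
  show "least_fp F T ?f \<in> D F T" by (rule least_fp_in[OF assms(1) f mono])
  show "?f (least_fp F T ?f) = least_fp F T ?f" by (rule least_fp_fixed[OF assms(1) f mono])
  show "y \<in> D F T \<Longrightarrow> le F T (?f y) y \<Longrightarrow> le F T (least_fp F T ?f) y"
    by (rule least_fp_least[OF assms(1) f mono])
qed

text \<open>The least fixpoint for the larger environment is a pre-fixpoint of the body taken in the
  smaller one.\<close>

lemma mono_sem_least_fp:
  assumes T: "complete_type F T" and e: "mono_sem F (\<Gamma>(X \<mapsto> T)) T e"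
  shows "mono_sem F \<Gamma> T (\<lambda>\<rho>. least_fp F T (\<lambda>x. e (\<rho>(X \<mapsto> x))))"
proof (rule mono_semI)
  fix \<rho> \<rho>' assume \<rho>: "\<rho> \<in> envs F \<Gamma>" "\<rho>' \<in> envs F \<Gamma>"
    and le: "\<And>Y B. \<Gamma> Y = Some B \<Longrightarrow> le F B (the (\<rho> Y)) (the (\<rho>' Y))"
  let ?m = "least_fp F T (\<lambda>x. e (\<rho>'(X \<mapsto> x)))"
  note m = least_fp_sem_in[OF T e \<rho>(2)] least_fp_sem_fixed[OF T e \<rho>(2)]
  then have "le F T (e (\<rho>(X \<mapsto> ?m))) ?m"
    using mono_sem_upd_le[OF e \<rho> le m(1) m(1) le_refl[OF m(1)]] by simp
  then show "le F T (least_fp F T (\<lambda>x. e (\<rho>(X \<mapsto> x)))) ?m"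
    by (rule least_fp_sem_least[OF T e \<rho>(1) m(1)])
qed (rule least_fp_sem_in[OF T e])

lemma mono_sem_greatest_fp:
  assumes "complete_type F T" and "mono_sem F (\<Gamma>(X \<mapsto> T)) T e"
  shows "mono_sem F \<Gamma> T (\<lambda>\<rho>. greatest_fp F T (\<lambda>x. e (\<rho>(X \<mapsto> x))))"
proof -
  interpret dual: po_frame "dual F" k by (rule po_frame_dual)
  show ?thesis
    using mono_sem_dual[OF dual.mono_sem_least_fp[OF complete_type_dual mono_sem_dual]] assms
    by (simp add: greatest_fp_dual)
qed

end


section \<open>The two semantics are well defined and monotone\<close>

lemma po_frame_hfa: "full k (hfa_frame g) \<Longrightarrow> po_frame (hfa_frame g) k"
proof
  fix i and x y z :: hgnd
  show "x \<in> gcar (hfa_frame g) i \<Longrightarrow> gle (hfa_frame g) i x x"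
    by (cases i) (auto simp: hfa_frame_def)
  show "gle (hfa_frame g) i x y \<Longrightarrow> gle (hfa_frame g) i y z \<Longrightarrow> gle (hfa_frame g) i x z"
    by (cases i) (auto simp: hfa_frame_def)
  show "x \<in> gcar (hfa_frame g) i \<Longrightarrow> y \<in> gcar (hfa_frame g) i \<Longrightarrow>
      gle (hfa_frame g) i x y \<Longrightarrow> gle (hfa_frame g) i y x \<Longrightarrow> x = y"
    by (cases i) (auto simp: hfa_frame_def)
qed

lemma po_frame_phfl:
  fixes h :: "'d \<Rightarrow> (('s \<Rightarrow> real, 'd) val \<rightharpoonup> ('s \<Rightarrow> real, 'd) val)"
  shows "full k (phfl_frame h) \<Longrightarrow> po_frame (phfl_frame h) k"
proof
  fix i and x y z :: "'s \<Rightarrow> real"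
  show "x \<in> gcar (phfl_frame h) i \<Longrightarrow> gle (phfl_frame h) i x x"
    by (simp add: phfl_frame_def)
  show "gle (phfl_frame h) i x y \<Longrightarrow> gle (phfl_frame h) i y z \<Longrightarrow> gle (phfl_frame h) i x z"
    by (auto simp: phfl_frame_def intro: order_trans)
  show "gle (phfl_frame h) i x y \<Longrightarrow> gle (phfl_frame h) i y x \<Longrightarrow> x = y"
    by (auto simp: phfl_frame_def intro!: ext antisym)
qed

section \<open>Ground domains and completeness of types\<close>

lemma min_max_bool [simp]:
  "min a b \<longleftrightarrow> a \<and> b" "max a b \<longleftrightarrow> a \<or> b" for a b :: bool
  by (auto simp: min_def max_def)

lemma D_hfa_ground [simp]:
  "x \<in> D (hfa_frame g) TNat \<longleftrightarrow> (\<exists>n. x = Gnd (Num n))"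
  "x \<in> D (hfa_frame g) TProp \<longleftrightarrow> (\<exists>b. x = Gnd (Tv b))"
  by (auto simp: hfa_frame_def)

lemma le_hfa_ground [simp]:
  "le (hfa_frame g) TNat x y \<longleftrightarrow> gnd x = gnd y"
  "le (hfa_frame g) TProp x y \<longleftrightarrow> tv (gnd x) \<le> tv (gnd y)"
  by (auto simp: hfa_frame_def)

lemma D_phfl_ground [simp]:
  "x \<in> D (phfl_frame h) (Ground i) \<longleftrightarrow> (\<exists>u. x = Gnd u \<and> (\<forall>s. 0 \<le> u s \<and> u s \<le> 1))"
  by (auto simp: phfl_frame_def)

lemma le_phfl_ground [simp]:
  "le (phfl_frame h) (Ground i) x y \<longleftrightarrow> (\<forall>s. gnd x s \<le> gnd y s)"
  by (simp add: phfl_frame_def)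

declare D.simps(1) [simp del] le.simps(1) [simp del]

lemma complete_type_TProp: "complete_type (hfa_frame g) TProp"
  unfolding complete_type_def
proof (intro allI impI)
  fix S assume "S \<subseteq> D (hfa_frame g) TProp"
  then have "is_lub (hfa_frame g) TProp S (Gnd (Tv (\<exists>x\<in>S. tv (gnd x))))"
    by (auto simp: is_lub_def)
  then show "\<exists>u. is_lub (hfa_frame g) TProp S u" ..
qed

lemma complete_type_PProp: "complete_type (phfl_frame h) (Ground i)"
  unfolding complete_type_def
proof (intro allI impI)
  fix S assume S: "S \<subseteq> D (phfl_frame h) (Ground i)"
  \<comment> \<open>The real supremum over the empty set is unspecified; the value 0 is the bottom
    of the unit interval.\<close>
  define u where "u s = (if S = {} then 0 else SUP x\<in>S. gnd x s)" for s
  have 01: "0 \<le> gnd x s" "gnd x s \<le> 1" if "x \<in> S" for x s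
    using subsetD[OF S that] by auto
  then have bdd: "bdd_above ((\<lambda>x. gnd x s) ` S)" for s by (auto intro!: bdd_aboveI)
  have upper: "gnd x s \<le> u s" if "x \<in> S" for x s
    using that bdd by (auto simp: u_def intro: cSUP_upper)
  have least: "u s \<le> c" if "0 \<le> c" "\<And>x. x \<in> S \<Longrightarrow> gnd x s \<le> c" for s c
    using that by (auto simp: u_def intro: cSUP_least)
  have "0 \<le> u s" for s
  proof (cases "S = {}")
    case False
    then obtain x where "x \<in> S" by blast
    then show ?thesis using 01(1) upper order_trans by blast
  qed (simp add: u_def)
  moreover have "u s \<le> 1" for s using least 01 by simp
  ultimately have "is_lub (phfl_frame h) (Ground i) S (Gnd u)"
    using upper least by (auto simp: is_lub_def)
  then show "\<exists>u. is_lub (phfl_frame h) (Ground i) S u" ..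
qed

lemma complete_type_hfa:
  "full k (hfa_frame g) \<Longrightarrow> is_T T \<Longrightarrow> height T \<le> k \<Longrightarrow> complete_type (hfa_frame g) T"
proof (induction T)
  case (Ground i)
  then show ?case by (simp add: complete_type_TProp)
next
  case (Arr A T)
  interpret po_frame "hfa_frame g" k using Arr.prems(1) by (rule po_frame_hfa)
  show ?case using Arr by (intro complete_type_arr) auto
qed

lemma complete_type_phfl:
  "full k (phfl_frame h) \<Longrightarrow> height T \<le> k \<Longrightarrow> complete_type (phfl_frame h) T"
proof (induction T)
  case (Ground i)
  then show ?case by (simp add: complete_type_PProp)
next
  case (Arr A T)
  interpret po_frame "phfl_frame h" k using Arr.prems(1) by (rule po_frame_phfl)
  show ?case using Arr by (intro complete_type_arr) auto
qed

section \<open>Well-definedness of the arithmetic semantics\<close>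

lemma derivation_types_typed: "hfa_typed \<Gamma> \<psi> A \<Longrightarrow> A \<in> derivation_types \<psi> \<Gamma>"
  by (cases \<psi>) auto

lemma mono_sem_hterm:
  "hterm_typed \<Gamma> s A \<Longrightarrow> mono_sem (hfa_frame g) \<Gamma> A (hterm_sem s)"
proof (induction rule: hterm_typed.induct)
  case (1 \<Gamma> X A)
  then show ?case by (simp add: mono_sem_def envs_def)
qed (simp_all add: mono_sem_def)

lemma mono_sem_hfa:
  assumes full: "full k (hfa_frame g)"
  shows "hfa_typed \<Gamma> \<psi> A \<Longrightarrow> \<forall>B\<in>derivation_types \<psi> \<Gamma>. height B \<le> k \<Longrightarrow>
    mono_sem (hfa_frame g) \<Gamma> A (hfa_sem (hfa_frame g) \<psi>)"
proof (induction rule: hfa_typed.induct)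
  case (1 \<Gamma> s A)
  then show ?case using mono_sem_hterm by (simp add: mono_sem_def)
next
  case (2 \<Gamma> s t)
  then show ?case using mono_sem_hterm[of \<Gamma> s TNat g] mono_sem_hterm[of \<Gamma> t TNat g]
    by (simp add: mono_sem_def)
next
  case (3 \<Gamma> a b)
  then have "mono_sem (hfa_frame g) \<Gamma> TProp (hfa_sem (hfa_frame g) a)"
    "mono_sem (hfa_frame g) \<Gamma> TProp (hfa_sem (hfa_frame g) b)" by auto
  then show ?case by (simp add: mono_sem_def)
next
  case (4 \<Gamma> a b)
  then have "mono_sem (hfa_frame g) \<Gamma> TProp (hfa_sem (hfa_frame g) a)"
    "mono_sem (hfa_frame g) \<Gamma> TProp (hfa_sem (hfa_frame g) b)" by auto
  then show ?case by (simp add: mono_sem_def)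
next
  case (5 A T \<Gamma> X a)
  interpret po_frame "hfa_frame g" k using full by (rule po_frame_hfa)
  have "A \<rightarrowtail> T \<in> derivation_types (Lam X A a) \<Gamma>"
    by (rule derivation_types_typed[OF hfa_typed.intros(5)[OF 5(1-3)]])
  with "5.prems" have k: "height (A \<rightarrowtail> T) \<le> k" by blast
  have "mono_sem (hfa_frame g) (\<Gamma>(X \<mapsto> A)) T (hfa_sem (hfa_frame g) a)"
    by (rule "5.IH") (use "5.prems" in \<open>simp del: fun_upd_apply\<close>)
  then show ?case using mono_sem_lam[OF k] by simp
next
  case (6 \<Gamma> a A T b)
  interpret po_frame "hfa_frame g" k using full by (rule po_frame_hfa)
  show ?case using 6 by (auto intro: mono_sem_app)
next
  case (7 T \<Gamma> X a)
  interpret po_frame "hfa_frame g" k using full by (rule po_frame_hfa)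
  from 7 have "height T \<le> k" using derivation_types_typed by simp
  moreover have "mono_sem (hfa_frame g) (\<Gamma>(X \<mapsto> T)) T (hfa_sem (hfa_frame g) a)"
    by (rule "7.IH") (use "7.prems" in \<open>simp del: fun_upd_apply\<close>)
  ultimately show ?case using mono_sem_least_fp[OF complete_type_hfa[OF full 7(1)]] by simp
next
  case (8 T \<Gamma> X a)
  interpret po_frame "hfa_frame g" k using full by (rule po_frame_hfa)
  from 8 have "height T \<le> k" using derivation_types_typed by simp
  moreover have "mono_sem (hfa_frame g) (\<Gamma>(X \<mapsto> T)) T (hfa_sem (hfa_frame g) a)"
    by (rule "8.IH") (use "8.prems" in \<open>simp del: fun_upd_apply\<close>)
  ultimately show ?case using mono_sem_greatest_fp[OF complete_type_hfa[OF full 8(1)]] by simp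
qed

section \<open>PHFL connectives and translated formulas\<close>

lemma mono_sem_Atom: "mono_sem (phfl_frame h) \<Gamma> (Ground i) (phfl_sem C (phfl_frame h) (Atom p))"
  by (simp add: mono_sem_def)

lemma mono_sem_PAnd:
  assumes "mono_sem (phfl_frame h) \<Gamma> (Ground i) (phfl_sem C (phfl_frame h) a)"
    and "mono_sem (phfl_frame h) \<Gamma> (Ground i) (phfl_sem C (phfl_frame h) b)"
  shows "mono_sem (phfl_frame h) \<Gamma> (Ground i) (phfl_sem C (phfl_frame h) (PAnd a b))"
proof (rule mono_semI)
  fix \<eta> assume "\<eta> \<in> envs (phfl_frame h) \<Gamma>"
  note assms[THEN mono_sem_in, OF this]
  then show "phfl_sem C (phfl_frame h) (PAnd a b) \<eta> \<in> D (phfl_frame h) (Ground i)"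
    by (auto simp: min_def)
next
  fix \<eta> \<eta>' assume "\<eta> \<in> envs (phfl_frame h) \<Gamma>" "\<eta>' \<in> envs (phfl_frame h) \<Gamma>"
    "\<And>X A. \<Gamma> X = Some A \<Longrightarrow> le (phfl_frame h) A (the (\<eta> X)) (the (\<eta>' X))"
  note assms[THEN mono_sem_le, OF this]
  then show "le (phfl_frame h) (Ground i) (phfl_sem C (phfl_frame h) (PAnd a b) \<eta>)
      (phfl_sem C (phfl_frame h) (PAnd a b) \<eta>')"
    by (simp add: min.coboundedI1 min.coboundedI2)
qed

lemma mono_sem_POr:
  assumes "mono_sem (phfl_frame h) \<Gamma> (Ground i) (phfl_sem C (phfl_frame h) a)"
    and "mono_sem (phfl_frame h) \<Gamma> (Ground i) (phfl_sem C (phfl_frame h) b)"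
  shows "mono_sem (phfl_frame h) \<Gamma> (Ground i) (phfl_sem C (phfl_frame h) (POr a b))"
proof (rule mono_semI)
  fix \<eta> assume "\<eta> \<in> envs (phfl_frame h) \<Gamma>"
  note assms[THEN mono_sem_in, OF this]
  then show "phfl_sem C (phfl_frame h) (POr a b) \<eta> \<in> D (phfl_frame h) (Ground i)"
    by (auto simp: max_def)
next
  fix \<eta> \<eta>' assume "\<eta> \<in> envs (phfl_frame h) \<Gamma>" "\<eta>' \<in> envs (phfl_frame h) \<Gamma>"
    "\<And>X A. \<Gamma> X = Some A \<Longrightarrow> le (phfl_frame h) A (the (\<eta> X)) (the (\<eta>' X))"
  note assms[THEN mono_sem_le, OF this]
  then show "le (phfl_frame h) (Ground i) (phfl_sem C (phfl_frame h) (POr a b) \<eta>)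
      (phfl_sem C (phfl_frame h) (POr a b) \<eta>')"
    by (simp add: max.coboundedI1 max.coboundedI2)
qed

lemma mono_sem_Thr:
  assumes "mono_sem (phfl_frame h) \<Gamma> (Ground i) (phfl_sem C (phfl_frame h) a)"
  shows "mono_sem (phfl_frame h) \<Gamma> (Ground i) (phfl_sem C (phfl_frame h) (Thr a J))"
proof (rule mono_semI)
  fix \<eta> \<eta>' assume "\<eta> \<in> envs (phfl_frame h) \<Gamma>" "\<eta>' \<in> envs (phfl_frame h) \<Gamma>"
    "\<And>X A. \<Gamma> X = Some A \<Longrightarrow> le (phfl_frame h) A (the (\<eta> X)) (the (\<eta>' X))"
  note le = mono_sem_le[OF assms this]
  \<comment> \<open>Both kinds of threshold are upward closed.\<close>
  have "meets J x \<Longrightarrow> x \<le> y \<Longrightarrow> meets J y" for x y by (cases J) auto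
  with le show "le (phfl_frame h) (Ground i) (phfl_sem C (phfl_frame h) (Thr a J) \<eta>)
      (phfl_sem C (phfl_frame h) (Thr a J) \<eta>')"
    by auto
qed simp

text \<open>Nonnegative weights give monotonicity and the lower bound 0; rows summing to 1 keep the
  average at most 1.\<close>

lemma mono_sem_Next:
  assumes C: "is_markov_chain C"
    and a: "mono_sem (phfl_frame h) \<Gamma> (Ground i) (phfl_sem C (phfl_frame h) a)"
  shows "mono_sem (phfl_frame h) \<Gamma> (Ground i) (phfl_sem C (phfl_frame h) (Next a))"
proof (rule mono_semI)
  have P: "0 \<le> trans_prob C s s'" "(\<Sum>s'\<in>UNIV. trans_prob C s s') = 1" for s s'
    using C by (auto simp: is_markov_chain_def)
  {
    fix \<eta> assume "\<eta> \<in> envs (phfl_frame h) \<Gamma>"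
    from mono_sem_in[OF a this] obtain u where
      u: "phfl_sem C (phfl_frame h) a \<eta> = Gnd u" "\<And>s. 0 \<le> u s" "\<And>s. u s \<le> 1" by auto
    have "(\<Sum>s'\<in>UNIV. trans_prob C s s' * u s') \<le> (\<Sum>s'\<in>UNIV. trans_prob C s s')" for s
      using P u by (intro sum_mono) (simp add: mult_left_le)
    then show "phfl_sem C (phfl_frame h) (Next a) \<eta> \<in> D (phfl_frame h) (Ground i)"
      using P u by (auto intro!: sum_nonneg)
  next
    fix \<eta> \<eta>' assume "\<eta> \<in> envs (phfl_frame h) \<Gamma>" "\<eta>' \<in> envs (phfl_frame h) \<Gamma>"
      "\<And>X A. \<Gamma> X = Some A \<Longrightarrow> le (phfl_frame h) A (the (\<eta> X)) (the (\<eta>' X))"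
    note mono_sem_le[OF a this]
    then show "le (phfl_frame h) (Ground i) (phfl_sem C (phfl_frame h) (Next a) \<eta>)
        (phfl_sem C (phfl_frame h) (Next a) \<eta>')"
      using P by (auto intro!: sum_mono mult_left_mono)
  }
qed

lemmas mono_sem_phfl_prop =
  mono_sem_Atom mono_sem_PAnd mono_sem_POr mono_sem_Thr mono_sem_Next[OF is_markov_chain_M]

lemma mono_sem_tr_term:
  "hterm_typed \<Gamma> s A \<Longrightarrow>
    mono_sem (phfl_frame h) (tr_ctx \<Gamma>) (tr_ty A) (phfl_sem M (phfl_frame h) (tr_term s))"
proof (induction rule: hterm_typed.induct)
  case (1 \<Gamma> X A)
  then have "tr_ctx \<Gamma> X = Some (tr_ty A)" by (simp add: tr_ctx_def)
  then show ?case by (simp add: mono_sem_def envs_def)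
next
  case (2 \<Gamma>)
  show ?case unfolding tr_term.simps tr_ty.simps by (rule mono_sem_Atom)
next
  case (3 \<Gamma> s)
  then show ?case unfolding tr_term.simps tr_ty.simps by (intro mono_sem_phfl_prop)
qed

text \<open>The induction follows the arithmetic typing, so the height condition can be stated on
  the derivation of \<open>\<psi>\<close>; it transfers because \<open>tr_ty\<close> preserves
  heights.\<close>

lemma mono_sem_tr:
  assumes full: "full k (phfl_frame h)"
  shows "hfa_typed \<Gamma> \<psi> A \<Longrightarrow> \<forall>B\<in>derivation_types \<psi> \<Gamma>. height B \<le> k \<Longrightarrow>
    mono_sem (phfl_frame h) (tr_ctx \<Gamma>) (tr_ty A) (phfl_sem M (phfl_frame h) (tr \<psi>))"
proof (induction rule: hfa_typed.induct)
  case (1 \<Gamma> s A)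
  then show ?case by (simp add: mono_sem_tr_term)
next
  case (2 \<Gamma> s t)
  note mono_sem_tr_term[OF 2(1)] mono_sem_tr_term[OF 2(2)]
  then show ?case unfolding tr.simps tr_ty.simps by (intro mono_sem_phfl_prop)
next
  case (3 \<Gamma> a b)
  then show ?case by (auto intro: mono_sem_PAnd simp del: phfl_sem.simps)
next
  case (4 \<Gamma> a b)
  then show ?case by (auto intro: mono_sem_POr simp del: phfl_sem.simps)
next
  case (5 A T \<Gamma> X a)
  interpret po_frame "phfl_frame h" k using full by (rule po_frame_phfl)
  have "A \<rightarrowtail> T \<in> derivation_types (Lam X A a) \<Gamma>"
    by (rule derivation_types_typed[OF hfa_typed.intros(5)[OF 5(1-3)]])
  with "5.prems" have "height (A \<rightarrowtail> T) \<le> k" by blast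
  then have k: "height (tr_ty A \<rightarrowtail> tr_ty T) \<le> k" by (simp add: height_tr_ty)
  have "mono_sem (phfl_frame h) (tr_ctx (\<Gamma>(X \<mapsto> A))) (tr_ty T) (phfl_sem M (phfl_frame h) (tr a))"
    by (rule "5.IH") (use "5.prems" in \<open>simp del: fun_upd_apply\<close>)
  then show ?case using mono_sem_lam[OF k] by (simp add: tr_ctx_upd)
next
  case (6 \<Gamma> a A T b)
  interpret po_frame "phfl_frame h" k using full by (rule po_frame_phfl)
  show ?case using 6 by (auto intro: mono_sem_app)
next
  case (7 T \<Gamma> X a)
  interpret po_frame "phfl_frame h" k using full by (rule po_frame_phfl)
  from 7 have "height (tr_ty T) \<le> k" using derivation_types_typed by (simp add: height_tr_ty)
  moreover have "mono_sem (phfl_frame h) (tr_ctx (\<Gamma>(X \<mapsto> T))) (tr_ty T) (phfl_sem M (phfl_frame h) (tr a))"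
    by (rule "7.IH") (use "7.prems" in \<open>simp del: fun_upd_apply\<close>)
  ultimately show ?case
    using mono_sem_least_fp[OF complete_type_phfl[OF full]] by (simp add: tr_ctx_upd)
next
  case (8 T \<Gamma> X a)
  interpret po_frame "phfl_frame h" k using full by (rule po_frame_phfl)
  from 8 have "height (tr_ty T) \<le> k" using derivation_types_typed by (simp add: height_tr_ty)
  moreover have "mono_sem (phfl_frame h) (tr_ctx (\<Gamma>(X \<mapsto> T))) (tr_ty T) (phfl_sem M (phfl_frame h) (tr a))"
    by (rule "8.IH") (use "8.prems" in \<open>simp del: fun_upd_apply\<close>)
  ultimately show ?case
    using mono_sem_greatest_fp[OF complete_type_phfl[OF full]] by (simp add: tr_ctx_upd)
qed


section \<open>The relations are closed under suprema, infima and fixpoints\<close>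

lemma rel_D: "rel F G A x y \<Longrightarrow> x \<in> D F A \<and> y \<in> D G (tr_ty A)"
  by (cases A) auto

lemma rel_dual [simp]: "rel (dual F) (dual G) A x y = rel F G A x y"
  by (induction A arbitrary: x y) (simp_all del: D.simps)

text \<open>A set of pairs keeps the two components matched, so at function types both can be
  applied to related arguments at once. The set may be empty, which makes bottom elements related.
  Closure under infima is this property for the dual frames.\<close>

definition lub_closed ::
  "(hbase, hgnd, 'c) frame \<Rightarrow> (pbase, state \<Rightarrow> real, 'd) frame \<Rightarrow> hbase sty \<Rightarrow> bool" where
  "lub_closed F G T \<longleftrightarrow> (\<forall>W u v. (\<forall>(x, y)\<in>W. rel F G T x y) \<longrightarrow>
     is_lub F T (fst ` W) u \<longrightarrow> is_lub G (tr_ty T) (snd ` W) v \<longrightarrow> rel F G T u v)"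

lemma lub_closed_TProp: "lub_closed (hfa_frame g) (phfl_frame h) TProp"
  unfolding lub_closed_def
proof (intro allI impI)
  fix W u v
  assume W: "\<forall>(x, y)\<in>W. rel (hfa_frame g) (phfl_frame h) TProp x y"
    and u: "is_lub (hfa_frame g) TProp (fst ` W) u"
    and v: "is_lub (phfl_frame h) (tr_ty TProp) (snd ` W) v"
  from u obtain b where b: "u = Gnd (Tv b)" by (auto simp: is_lub_def)
  from v obtain r where r: "v = Gnd r" "\<And>s. 0 \<le> r s" "\<And>s. r s \<le> 1" by (auto simp: is_lub_def)
  have "of_bool b = r s0"
  proof (cases "\<exists>(x, y)\<in>W. tv (gnd x)")
    case True
    then obtain x y where xy: "(x, y) \<in> W" "tv (gnd x)" by blast
    then have "gnd y s0 = 1" using W by auto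
    moreover have "gnd y s0 \<le> r s0" "tv (gnd x) \<le> b"
      using u v xy by (force simp: is_lub_def b r)+
    ultimately show ?thesis using r(3)[of s0] xy by auto
  next
    case False
    have "le (hfa_frame g) TProp u (Gnd (Tv False))"
      by (rule is_lub_least[OF u]) (use False in auto)
    then have "\<not> b" by (simp add: b)
    \<comment> \<open>The relation forces 0 at \<open>s0\<close> when the truth value is false and
      says nothing about the other states beyond the unit interval, so the upper bound has to be 1
      there.\<close>
    let ?t = "Gnd (\<lambda>s. if s = s0 then 0 else 1 :: real)"
    have t: "gnd y s \<le> gnd ?t s" if "(x, y) \<in> W" for x y s
      using bspec[OF W that] False that by (cases "s = s0") auto
    have "le (phfl_frame h) (tr_ty TProp) v ?t"
    proof (rule is_lub_least[OF v])
      fix y assume "y \<in> snd ` W"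
      then obtain x where "(x, y) \<in> W" by force
      then show "le (phfl_frame h) (tr_ty TProp) y ?t"
        unfolding tr_ty.simps le_phfl_ground by (intro allI t)
    qed simp
    then have "r s0 \<le> 0" by (auto simp: r dest: spec[of _ s0])
    then show ?thesis using r(2)[of s0] \<open>\<not> b\<close> by simp
  qed
  then show "rel (hfa_frame g) (phfl_frame h) TProp u v" using b r by simp
qed

lemma lub_closed_dual_TProp: "lub_closed (dual (hfa_frame g)) (dual (phfl_frame h)) TProp"
  unfolding lub_closed_def
proof (intro allI impI)
  fix W u v
  assume W: "\<forall>(x, y)\<in>W. rel (dual (hfa_frame g)) (dual (phfl_frame h)) TProp x y"
    and u: "is_lub (dual (hfa_frame g)) TProp (fst ` W) u"
    and v: "is_lub (dual (phfl_frame h)) (tr_ty TProp) (snd ` W) v"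
  from u obtain b where b: "u = Gnd (Tv b)" by (auto simp: is_lub_def)
  from v obtain r where r: "v = Gnd r" "\<And>s. 0 \<le> r s" "\<And>s. r s \<le> 1" by (auto simp: is_lub_def)
  have "of_bool b = r s0"
  proof (cases "\<exists>(x, y)\<in>W. \<not> tv (gnd x)")
    case True
    then obtain x y where xy: "(x, y) \<in> W" "\<not> tv (gnd x)" by blast
    then have "gnd y s0 = 0" using W by auto
    moreover have "r s0 \<le> gnd y s0" "b \<le> tv (gnd x)"
      using u v xy by (force simp: is_lub_def b r)+
    ultimately show ?thesis using r(2)[of s0] xy by auto
  next
    case False
    have "le (dual (hfa_frame g)) TProp u (Gnd (Tv True))"
      by (rule is_lub_least[OF u]) (use False in auto)
    then have "b" by (simp add: b)
    \<comment> \<open>In the original order this is a lower bound: every second component is 1 at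
      \<open>s0\<close>, and elsewhere only nonnegativity is known.\<close>
    let ?t = "Gnd (\<lambda>s. if s = s0 then 1 else 0 :: real)"
    have t: "gnd ?t s \<le> gnd y s" if "(x, y) \<in> W" for x y s
      using bspec[OF W that] False that by (cases "s = s0") auto
    have "le (dual (phfl_frame h)) (tr_ty TProp) v ?t"
    proof (rule is_lub_least[OF v])
      fix y assume "y \<in> snd ` W"
      then obtain x where "(x, y) \<in> W" by force
      then show "le (dual (phfl_frame h)) (tr_ty TProp) y ?t"
        unfolding tr_ty.simps le_dual le_phfl_ground by (intro allI t)
    qed simp
    then have "1 \<le> r s0" by (auto simp: r dest: spec[of _ s0])
    then show ?thesis using r(3)[of s0] \<open>b\<close> by simp
  qed
  then show "rel (dual (hfa_frame g)) (dual (phfl_frame h)) TProp u v" using b r by simp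
qed

text \<open>Applying all pairs of \<open>W\<close> to one related pair of arguments gives a set of
  related pairs at the result type, whose suprema are the applied suprema. General frames are
  allowed so that the dual frames are an instance.\<close>

lemma lub_closed_arr:
  assumes F: "po_frame F k" and G: "po_frame G l"
    and k: "height (A \<rightarrowtail> T) \<le> k" and l: "height (A \<rightarrowtail> T) \<le> l"
    and FT: "complete_type F T" and GT: "complete_type G (tr_ty T)"
    and closed: "lub_closed F G T"
  shows "lub_closed F G (A \<rightarrowtail> T)"
  unfolding lub_closed_def
proof (intro allI impI)
  fix W u v
  assume W: "\<forall>(x, y)\<in>W. rel F G (A \<rightarrowtail> T) x y"
    and u: "is_lub F (A \<rightarrowtail> T) (fst ` W) u"
    and v: "is_lub G (tr_ty (A \<rightarrowtail> T)) (snd ` W) v"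
  have WD: "fst ` W \<subseteq> D F (A \<rightarrowtail> T)" "snd ` W \<subseteq> D G (tr_ty A \<rightarrowtail> tr_ty T)"
  proof -
    have "f \<in> D F (A \<rightarrowtail> T) \<and> g \<in> D G (tr_ty A \<rightarrowtail> tr_ty T)" if "(f, g) \<in> W" for f g
      using bspec[OF W that] rel_D[of F G "A \<rightarrowtail> T" f g] by (simp only: prod.case tr_ty.simps)
    then show "fst ` W \<subseteq> D F (A \<rightarrowtail> T)" "snd ` W \<subseteq> D G (tr_ty A \<rightarrowtail> tr_ty T)" by fastforce+
  qed
  have l': "height (tr_ty A \<rightarrowtail> tr_ty T) \<le> l" using l by (simp add: height_tr_ty)
  have "rel F G T (app F u x) (app G v y)"
    if xy: "x \<in> D F A" "y \<in> D G (tr_ty A)" "rel F G A x y" for x y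
  proof -
    let ?W = "(\<lambda>(f, g). (app F f x, app G g y)) ` W"
    have "\<forall>(x, y)\<in>?W. rel F G T x y" using W xy by auto
    moreover have "is_lub F T (fst ` ?W) (app F u x)"
      using po_frame.lub_arr_app[OF F k FT WD(1) u xy(1)]
      by (simp add: image_image case_prod_unfold)
    moreover have "is_lub G (tr_ty T) (snd ` ?W) (app G v y)"
      using po_frame.lub_arr_app[OF G l' GT WD(2) _ xy(2)] v
      by (simp add: image_image case_prod_unfold del: D.simps)
    ultimately show ?thesis using closed unfolding lub_closed_def by blast
  qed
  then show "rel F G (A \<rightarrowtail> T) u v" using u v by (simp add: is_lub_def)
qed

text \<open>The dual half serves greatest fixpoints. The restriction to \<open>is_T\<close> leaves
  \<open>TProp\<close> as the only ground case.\<close>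

lemma lub_closed:
  assumes F: "full k (hfa_frame g)" and G: "full l (phfl_frame h)"
  shows "is_T T \<Longrightarrow> height T \<le> k \<Longrightarrow> height T \<le> l \<Longrightarrow>
    lub_closed (hfa_frame g) (phfl_frame h) T \<and>
    lub_closed (dual (hfa_frame g)) (dual (phfl_frame h)) T"
proof (induction T)
  case (Ground i)
  then show ?case by (simp add: lub_closed_TProp lub_closed_dual_TProp)
next
  case (Arr A T)
  note po = po_frame_hfa[OF F] po_frame_phfl[OF G]
  have "complete_type (hfa_frame g) T" "complete_type (phfl_frame h) (tr_ty T)"
    using Arr.prems complete_type_hfa[OF F] complete_type_phfl[OF G] by (simp_all add: height_tr_ty)
  then show ?case
    using Arr lub_closed_arr[OF po Arr.prems(2,3)]
      lub_closed_arr[OF po[THEN po_frame.po_frame_dual] Arr.prems(2,3)]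
    by (simp add: complete_type_dual)
qed

text \<open>
  The pairs of related post-fixpoints lying below the two least fixpoints have a related supremum,
  which is again such a pair and hence, by maximality, consists of the two least fixpoints.
\<close>

lemma rel_least_fp:
  assumes F: "po_frame F k" and G: "po_frame G l"
    and FT: "complete_type F T" and GT: "complete_type G (tr_ty T)"
    and closed: "lub_closed F G T"
    and f: "\<And>x. x \<in> D F T \<Longrightarrow> f x \<in> D F T"
      "\<And>x y. x \<in> D F T \<Longrightarrow> y \<in> D F T \<Longrightarrow> le F T x y \<Longrightarrow> le F T (f x) (f y)"
    and g: "\<And>x. x \<in> D G (tr_ty T) \<Longrightarrow> g x \<in> D G (tr_ty T)"
      "\<And>x y. x \<in> D G (tr_ty T) \<Longrightarrow> y \<in> D G (tr_ty T) \<Longrightarrow> le G (tr_ty T) x y \<Longrightarrow>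
        le G (tr_ty T) (g x) (g y)"
    and rel: "\<And>x y. rel F G T x y \<Longrightarrow> rel F G T (f x) (g y)"
  shows "rel F G T (least_fp F T f) (least_fp G (tr_ty T) g)"
proof -
  interpret F: po_frame F k by (rule F)
  interpret G: po_frame G l by (rule G)
  define m where "m = least_fp F T f"
  define n where "n = least_fp G (tr_ty T) g"
  have m: "m \<in> D F T" "f m = m"
    unfolding m_def by (rule F.least_fp_in[OF FT f] F.least_fp_fixed[OF FT f]; assumption)+
  have n: "n \<in> D G (tr_ty T)" "g n = n"
    unfolding n_def by (rule G.least_fp_in[OF GT g] G.least_fp_fixed[OF GT g]; assumption)+
  define W where "W = {(x, y). rel F G T x y \<and> le F T x (f x) \<and> le F T x m \<and>
    le G (tr_ty T) y (g y) \<and> le G (tr_ty T) y n}"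
  have WD: "fst ` W \<subseteq> D F T" "snd ` W \<subseteq> D G (tr_ty T)"
    by (auto simp: W_def dest: rel_D)
  obtain u where u: "is_lub F T (fst ` W) u"
    using FT WD(1) unfolding complete_type_def by blast
  obtain v where v: "is_lub G (tr_ty T) (snd ` W) v"
    using GT WD(2) unfolding complete_type_def by blast
  note uv = u v
  have uvD: "u \<in> D F T" "v \<in> D G (tr_ty T)"
    using uv by (simp_all add: is_lub_def)
  have upper: "le F T x u" "le G (tr_ty T) y v" if "(x, y) \<in> W" for x y
    using uv bspec[OF _ that] by (force simp: is_lub_def)+
  have u_least: "le F T u z" if "z \<in> D F T" "\<And>x y. (x, y) \<in> W \<Longrightarrow> le F T x z" for z
    by (rule is_lub_least[OF uv(1) that(1)]) (use that(2) in force)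
  have v_least: "le G (tr_ty T) v z"
    if "z \<in> D G (tr_ty T)" "\<And>x y. (x, y) \<in> W \<Longrightarrow> le G (tr_ty T) y z" for z
    by (rule is_lub_least[OF uv(2) that(1)]) (use that(2) in force)
  have W: "x \<in> D F T" "y \<in> D G (tr_ty T)" "le F T x (f x)" "le F T x m"
    "le G (tr_ty T) y (g y)" "le G (tr_ty T) y n" if "(x, y) \<in> W" for x y
    using that by (auto simp: W_def dest: rel_D)
  have m_least: "le F T m x" if "x \<in> D F T" "le F T (f x) x" for x
    unfolding m_def by (rule F.least_fp_least[where f = f, OF FT f that]; assumption)
  have n_least: "le G (tr_ty T) n x" if "x \<in> D G (tr_ty T)" "le G (tr_ty T) (g x) x" for x
    unfolding n_def by (rule G.least_fp_least[where f = g, OF GT g that]; assumption)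
  have um: "le F T u m" by (rule u_least[OF m(1) W(4)])
  have vn: "le G (tr_ty T) v n" by (rule v_least[OF n(1) W(6)])
  have post: "le F T u (f u)" "le G (tr_ty T) v (g v)"
  proof -
    \<comment> \<open>Since \<open>x\<close> is a post-fixpoint below \<open>u\<close>, it is below
      \<open>f x\<close> and hence below \<open>f u\<close>; thus \<open>f u\<close> bounds all
      first components.\<close>
    have "le F T x (f u)" if "(x, y) \<in> W" for x y
      by (rule F.le_trans[OF W(1)[OF that] f(1)[OF W(1)[OF that]] f(1)[OF uvD(1)] W(3)[OF that]
            f(2)[OF W(1)[OF that] uvD(1) upper(1)[OF that]]])
    then show "le F T u (f u)" by (rule u_least[OF f(1)[OF uvD(1)]])
    have "le G (tr_ty T) y (g v)" if "(x, y) \<in> W" for x y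
      by (rule G.le_trans[OF W(2)[OF that] g(1)[OF W(2)[OF that]] g(1)[OF uvD(2)] W(5)[OF that]
            g(2)[OF W(2)[OF that] uvD(2) upper(2)[OF that]]])
    then show "le G (tr_ty T) v (g v)" by (rule v_least[OF g(1)[OF uvD(2)]])
  qed
  have "\<forall>(x, y)\<in>W. rel F G T x y" by (simp add: W_def)
  then have uv_rel: "rel F G T u v"
    using closed uv unfolding lub_closed_def by blast
  have "le F T (f u) m" "le G (tr_ty T) (g v) n"
    using f(2)[OF uvD(1) m(1) um] g(2)[OF uvD(2) n(1) vn] by (simp_all add: m n)
  \<comment> \<open>The pair one step further is placed in \<open>W\<close>, so it lies below
    \<open>(u, v)\<close>. This makes \<open>u\<close> and \<open>v\<close> pre-fixpoints, and
    minimality gives the missing inequalities.\<close>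
  then have "(f u, g v) \<in> W"
    using rel[OF uv_rel] f uvD g post by (simp add: W_def)
  then have "le F T m u" "le G (tr_ty T) n v" 
    using m_least[OF uvD(1)] n_least[OF uvD(2)] upper by blast+
  then have "u = m" "v = n"
    using F.le_antisym G.le_antisym um vn uvD m(1) n(1) by blast+
  then show ?thesis using uv_rel by (simp add: m_def n_def)
qed


section \<open>The fundamental property\<close>

lemma rel_env_upd:
  "rel_env F G \<Gamma> \<rho> \<eta> \<Longrightarrow> rel F G A x y \<Longrightarrow> rel_env F G (\<Gamma>(X \<mapsto> A)) (\<rho>(X \<mapsto> x)) (\<eta>(X \<mapsto> y))"
  by (simp add: rel_env_def)

lemma rel_TNat [simp]: "rel (hfa_frame g) (phfl_frame h) TNat x y \<longleftrightarrow>
    (\<exists>n u. x = Gnd (Num n) \<and> y = Gnd u \<and> (\<forall>s. 0 \<le> u s \<and> u s \<le> 1) \<and>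
       u s0 = (1/2) ^ n \<and> u s0' = 1 - (1/2) ^ n)"
  by auto

section \<open>Values in the four-state chain\<close>

lemma trans_prob_M: "trans_prob M = M_prob"
  and label_M: "label M = M_label"
  by (simp_all add: M_def)

lemma sum_M_prob:
  "(\<Sum>s'\<in>UNIV. M_prob s s' * u s') =
    (case s of s0 \<Rightarrow> (u s0' + u s1) / 2 | s0' \<Rightarrow> (u s0 + u s1') / 2 | s1 \<Rightarrow> u s0 | s1' \<Rightarrow> u s0')"
  by (cases s) (simp_all add: UNIV_state)

lemma gnd_phfl_sem:
  "gnd (phfl_sem C F (Atom p) \<eta>) s = (if s \<in> label C p then 1 else 0)"
  "gnd (phfl_sem C F (PAnd a b) \<eta>) s = min (gnd (phfl_sem C F a \<eta>) s) (gnd (phfl_sem C F b \<eta>) s)"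
  "gnd (phfl_sem C F (POr a b) \<eta>) s = max (gnd (phfl_sem C F a \<eta>) s) (gnd (phfl_sem C F b \<eta>) s)"
  "gnd (phfl_sem C F (Thr a J) \<eta>) s = (if meets J (gnd (phfl_sem C F a \<eta>) s) then 1 else 0)"
  by simp_all

text \<open>State-by-state evaluation: \<open>s1\<close> and \<open>s1'\<close> move with
  probability 1 and so copy the entries at \<open>s0\<close> and \<open>s0'\<close>, which is how
  nested \<open>Next\<close> operators in the translation read an encoded number.\<close>

lemma gnd_phfl_sem_Next_M:
  "gnd (phfl_sem M F (Next a) \<eta>) s0 =
    (gnd (phfl_sem M F a \<eta>) s0' + gnd (phfl_sem M F a \<eta>) s1) / 2"
  "gnd (phfl_sem M F (Next a) \<eta>) s0' =
    (gnd (phfl_sem M F a \<eta>) s0 + gnd (phfl_sem M F a \<eta>) s1') / 2"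
  "gnd (phfl_sem M F (Next a) \<eta>) s1 = gnd (phfl_sem M F a \<eta>) s0"
  "gnd (phfl_sem M F (Next a) \<eta>) s1' = gnd (phfl_sem M F a \<eta>) s0'"
  by (simp_all add: sum_M_prob trans_prob_M)

lemma rel_hterm:
  "hterm_typed \<Gamma> s A \<Longrightarrow> \<eta> \<in> envs (phfl_frame h) (tr_ctx \<Gamma>) \<Longrightarrow>
    rel_env (hfa_frame g) (phfl_frame h) \<Gamma> \<rho> \<eta> \<Longrightarrow>
    rel (hfa_frame g) (phfl_frame h) A (hterm_sem s \<rho>) (phfl_sem M (phfl_frame h) (tr_term s) \<eta>)"
proof (induction rule: hterm_typed.induct)
  case (1 \<Gamma> X A)
  then show ?case by (simp add: rel_env_def)
next
  case (2 \<Gamma>)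
  show ?case by (simp add: M_def)
next
  case (3 \<Gamma> s)
  then obtain n u where nu: "hterm_sem s \<rho> = Gnd (Num n)"
    "phfl_sem M (phfl_frame h) (tr_term s) \<eta> = Gnd u" "\<And>s. 0 \<le> u s" "\<And>s. u s \<le> 1"
    "u s0 = (1/2) ^ n" "u s0' = 1 - (1/2) ^ n"
    by auto
  have "hterm_typed \<Gamma> (Succ s) TNat" using 3 by (auto intro: hterm_typed.intros)
  \<comment> \<open>Membership in the unit interval at all four states comes from well-definedness,
    so only the entries at \<open>s0\<close> and \<open>s0'\<close> remain to be computed.\<close>
  from mono_sem_in[OF mono_sem_tr_term[OF this] "3.prems"(1)] obtain w where
    w: "phfl_sem M (phfl_frame h) (tr_term (Succ s)) \<eta> = Gnd w" "\<And>s. 0 \<le> w s" "\<And>s. w s \<le> 1"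
    unfolding tr_ty.simps D_phfl_ground by blast
  \<comment> \<open>The outer \<open>Next\<close> at \<open>s0\<close> averages \<open>s0'\<close>,
    where its body is 0, and \<open>s1\<close>, where the body copies \<open>u s0\<close>. At
    \<open>s0'\<close> it averages \<open>s0\<close>, where \<open>p0\<close> contributes 1, and
    \<open>s1'\<close>, where the body copies \<open>u s0'\<close>. Nonnegativity makes the minima
    with false atoms vanish.\<close>
  have "gnd (phfl_sem M (phfl_frame h) (tr_term (Succ s)) \<eta>) s0 = u s0 / 2"
    "gnd (phfl_sem M (phfl_frame h) (tr_term (Succ s)) \<eta>) s0' = (1 + u s0') / 2"
    using nu(3,4)[of s0] nu(3,4)[of s0'] nu(3)[of s1] nu(3)[of s1']
    by (simp_all add: gnd_phfl_sem gnd_phfl_sem_Next_M label_M nu(2) min_def max_def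
        del: phfl_sem.simps)
  then have "w s0 = u s0 / 2" "w s0' = (1 + u s0') / 2"
    by (simp_all only: w val.sel)
  then have "w s0 = (1/2) ^ Suc n" "w s0' = 1 - (1/2) ^ Suc n"
    using nu(5,6) by (simp_all add: field_simps)
  with w nu(1) show ?case by (simp del: tr_term.simps phfl_sem.simps)
qed

text \<open>The frames may be full up to different heights, hence two bounds. Both are imposed on
  every type of the derivation, so that they pass to the bodies of binders, and \<open>l\<close> can
  be compared with arithmetic types because translation preserves height.\<close>

lemma fundamental_property:
  fixes g :: "'c \<Rightarrow> ((hgnd, 'c) val \<rightharpoonup> (hgnd, 'c) val)"
    and h :: "'d \<Rightarrow> ((state \<Rightarrow> real, 'd) val \<rightharpoonup> (state \<Rightarrow> real, 'd) val)"
  assumes F: "full k (hfa_frame g)" and G: "full l (phfl_frame h)"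
  shows "hfa_typed \<Gamma> \<psi> A \<Longrightarrow> \<forall>B\<in>derivation_types \<psi> \<Gamma>. height B \<le> k \<and> height B \<le> l \<Longrightarrow>
    \<rho> \<in> envs (hfa_frame g) \<Gamma> \<Longrightarrow> \<eta> \<in> envs (phfl_frame h) (tr_ctx \<Gamma>) \<Longrightarrow>
    rel_env (hfa_frame g) (phfl_frame h) \<Gamma> \<rho> \<eta> \<Longrightarrow>
    rel (hfa_frame g) (phfl_frame h) A
      (hfa_sem (hfa_frame g) \<psi> \<rho>) (phfl_sem M (phfl_frame h) (tr \<psi>) \<eta>)"
proof (induction arbitrary: \<rho> \<eta> rule: hfa_typed.induct)
  case (1 \<Gamma> s A)
  then show ?case by (simp add: rel_hterm)
next
  case (2 \<Gamma> s t)
  obtain m u where u: "hterm_sem s \<rho> = Gnd (Num m)"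
    "phfl_sem M (phfl_frame h) (tr_term s) \<eta> = Gnd u" "\<And>s. 0 \<le> u s" "u s0 = (1/2) ^ m"
    using rel_hterm[OF 2(1) "2.prems"(3,4)] by auto
  obtain n v where v: "hterm_sem t \<rho> = Gnd (Num n)"
    "phfl_sem M (phfl_frame h) (tr_term t) \<eta> = Gnd v" "\<And>s. 0 \<le> v s" "v s0' = 1 - (1/2) ^ n"
    using rel_hterm[OF 2(2) "2.prems"(3,4)] by auto
  \<comment> \<open>The threshold asks whether \<open>(1/2) ^ m + 1 - (1/2) ^ n\<close> is at least
    1, that is, whether \<open>(1/2) ^ n\<close> is at most \<open>(1/2) ^ m\<close>; powers of 1/2
    strictly decrease.\<close>
  have leq: "1/2 \<le> (u s0 + v s0') / 2 \<longleftrightarrow> m \<le> n"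
    by (simp add: u v power_decreasing_iff)
  have "u s0 \<le> 1" "v s0' \<le> 1" by (simp_all add: u v power_le_one)
  \<comment> \<open>At \<open>s0\<close> the outer \<open>Next\<close> averages \<open>s0'\<close>,
    where \<open>p0'\<close> lets \<open>v s0'\<close> through, and \<open>s1\<close>, where
    \<open>p1\<close> lets through the copy of \<open>u s0\<close> made by the inner
    \<open>Next\<close>.\<close>
  then have s0: "gnd (phfl_sem M (phfl_frame h) (tr (Leq s t)) \<eta>) s0 =
      of_bool (1/2 \<le> (u s0 + v s0') / 2)"
    using u(3)[of s0] u(3)[of s0'] u(3)[of s1] u(3)[of s1'] v(3)[of s0'] v(3)[of s1]
    by (simp add: gnd_phfl_sem gnd_phfl_sem_Next_M label_M u(2) v(2) min_def max_def
        del: phfl_sem.simps)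
  have "phfl_sem M (phfl_frame h) (tr (Leq s t)) \<eta> \<in> D (phfl_frame h) (tr_ty TProp)"
    using "2.prems" by (intro mono_sem_in[OF mono_sem_tr[OF G hfa_typed.intros(2)[OF 2(1,2)]]]) auto
  then show ?case unfolding rel.simps s0 leq using u(1) v(1)
    by (simp del: tr.simps phfl_sem.simps D_phfl_ground)
next
  case (3 \<Gamma> a b)
  then have "rel (hfa_frame g) (phfl_frame h) TProp
      (hfa_sem (hfa_frame g) a \<rho>) (phfl_sem M (phfl_frame h) (tr a) \<eta>)"
    "rel (hfa_frame g) (phfl_frame h) TProp
      (hfa_sem (hfa_frame g) b \<rho>) (phfl_sem M (phfl_frame h) (tr b) \<eta>)" by auto
  then show ?case by (auto simp: min_def of_bool_def split: if_splits)
next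
  case (4 \<Gamma> a b)
  then have "rel (hfa_frame g) (phfl_frame h) TProp
      (hfa_sem (hfa_frame g) a \<rho>) (phfl_sem M (phfl_frame h) (tr a) \<eta>)"
    "rel (hfa_frame g) (phfl_frame h) TProp
      (hfa_sem (hfa_frame g) b \<rho>) (phfl_sem M (phfl_frame h) (tr b) \<eta>)" by auto
  then show ?case by (auto simp: max_def of_bool_def split: if_splits)
next
  case (5 A T \<Gamma> X a)
  interpret F: po_frame "hfa_frame g" k using F by (rule po_frame_hfa)
  interpret G: po_frame "phfl_frame h" l using G by (rule po_frame_phfl)
  have "A \<rightarrowtail> T \<in> derivation_types (Lam X A a) \<Gamma>"
    by (rule derivation_types_typed[OF hfa_typed.intros(5)[OF 5(1-3)]])
  with "5.prems"(1) have "height (A \<rightarrowtail> T) \<le> k" "height (A \<rightarrowtail> T) \<le> l" by blast+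
  then have h: "height (A \<rightarrowtail> T) \<le> k" "height (tr_ty A \<rightarrowtail> tr_ty T) \<le> l"
    by (simp_all add: height_tr_ty)
  have types: "\<forall>B\<in>derivation_types a (\<Gamma>(X \<mapsto> A)). height B \<le> k \<and> height B \<le> l"
    using 5 by simp
  then have a: "mono_sem (hfa_frame g) (\<Gamma>(X \<mapsto> A)) T (hfa_sem (hfa_frame g) a)"
    "mono_sem (phfl_frame h) ((tr_ctx \<Gamma>)(X \<mapsto> tr_ty A)) (tr_ty T)
      (phfl_sem M (phfl_frame h) (tr a))"
    using mono_sem_hfa[OF F 5(3)] mono_sem_tr[OF G 5(3)] by (simp_all add: tr_ctx_upd)
  note F_lam = F.lam_sem[OF h(1) a(1) "5.prems"(2)] and G_lam = G.lam_sem[OF h(2) a(2) "5.prems"(3)]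
  have "rel (hfa_frame g) (phfl_frame h) T (hfa_sem (hfa_frame g) a (\<rho>(X \<mapsto> x)))
      (phfl_sem M (phfl_frame h) (tr a) (\<eta>(X \<mapsto> y)))"
    if "x \<in> D (hfa_frame g) A" "y \<in> D (phfl_frame h) (tr_ty A)" "rel (hfa_frame g) (phfl_frame h) A x y"
    for x y
    by (rule "5.IH"[OF types envs_upd[OF "5.prems"(2) that(1)] _ rel_env_upd[OF "5.prems"(4) that(3)]])
      (simp only: tr_ctx_upd envs_upd[OF "5.prems"(3) that(2)])
  \<comment> \<open>Both abstractions reduce to their bodies on elements of the argument domains, so
    relatedness of the bodies is what the relation at the function type demands.\<close>
  then show ?case using F_lam G_lam by (simp del: D.simps)
next
  case (6 \<Gamma> a A T b)
  then have "rel (hfa_frame g) (phfl_frame h) (A \<rightarrowtail> T)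
      (hfa_sem (hfa_frame g) a \<rho>) (phfl_sem M (phfl_frame h) (tr a) \<eta>)"
    "rel (hfa_frame g) (phfl_frame h) A
      (hfa_sem (hfa_frame g) b \<rho>) (phfl_sem M (phfl_frame h) (tr b) \<eta>)" by auto
  then show ?case using rel_D by fastforce
next
  case (7 T \<Gamma> X a)
  note po = po_frame_hfa[OF F] po_frame_phfl[OF G]
  interpret F: po_frame "hfa_frame g" k by (rule po)
  interpret G: po_frame "phfl_frame h" l by (rule po)
  from 7 have h: "height T \<le> k" "height T \<le> l" "height (tr_ty T) \<le> l"
    using derivation_types_typed by (simp_all add: height_tr_ty)
  have types: "\<forall>B\<in>derivation_types a (\<Gamma>(X \<mapsto> T)). height B \<le> k \<and> height B \<le> l"
    using 7 by simp
  then have a: "mono_sem (hfa_frame g) (\<Gamma>(X \<mapsto> T)) T (hfa_sem (hfa_frame g) a)"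
    "mono_sem (phfl_frame h) ((tr_ctx \<Gamma>)(X \<mapsto> tr_ty T)) (tr_ty T)
      (phfl_sem M (phfl_frame h) (tr a))"
    using mono_sem_hfa[OF F 7(2)] mono_sem_tr[OF G 7(2)] by (simp_all add: tr_ctx_upd)
  have step: "rel (hfa_frame g) (phfl_frame h) T (hfa_sem (hfa_frame g) a (\<rho>(X \<mapsto> x)))
      (phfl_sem M (phfl_frame h) (tr a) (\<eta>(X \<mapsto> y)))"
    if "rel (hfa_frame g) (phfl_frame h) T x y" for x y
    by (rule "7.IH"[OF types envs_upd[OF "7.prems"(2) conjunct1[OF rel_D[OF that]]] _
          rel_env_upd[OF "7.prems"(4) that]])
      (simp only: tr_ctx_upd envs_upd[OF "7.prems"(3) conjunct2[OF rel_D[OF that]]])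
  show ?case
    unfolding hfa_sem.simps tr.simps phfl_sem.simps
    by (rule rel_least_fp[OF po complete_type_hfa[OF F 7(1) h(1)] complete_type_phfl[OF G h(3)]
          conjunct1[OF lub_closed[OF F G 7(1) h(1,2)]]])
      (use "7.prems"(2,3) step in \<open>auto intro: F.mono_sem_upd_in[OF a(1)]
        F.mono_sem_upd_mono[OF a(1)] G.mono_sem_upd_in[OF a(2)] G.mono_sem_upd_mono[OF a(2)]\<close>)
next
  case (8 T \<Gamma> X a)
  note po = po_frame_hfa[OF F] po_frame_phfl[OF G]
  interpret F: po_frame "hfa_frame g" k by (rule po)
  interpret G: po_frame "phfl_frame h" l by (rule po)
  from 8 have h: "height T \<le> k" "height T \<le> l" "height (tr_ty T) \<le> l"
    using derivation_types_typed by (simp_all add: height_tr_ty)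
  have types: "\<forall>B\<in>derivation_types a (\<Gamma>(X \<mapsto> T)). height B \<le> k \<and> height B \<le> l"
    using 8 by simp
  then have a: "mono_sem (hfa_frame g) (\<Gamma>(X \<mapsto> T)) T (hfa_sem (hfa_frame g) a)"
    "mono_sem (phfl_frame h) ((tr_ctx \<Gamma>)(X \<mapsto> tr_ty T)) (tr_ty T)
      (phfl_sem M (phfl_frame h) (tr a))"
    using mono_sem_hfa[OF F 8(2)] mono_sem_tr[OF G 8(2)] by (simp_all add: tr_ctx_upd)
  have step: "rel (hfa_frame g) (phfl_frame h) T (hfa_sem (hfa_frame g) a (\<rho>(X \<mapsto> x)))
      (phfl_sem M (phfl_frame h) (tr a) (\<eta>(X \<mapsto> y)))"
    if "rel (hfa_frame g) (phfl_frame h) T x y" for x y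
    by (rule "8.IH"[OF types envs_upd[OF "8.prems"(2) conjunct1[OF rel_D[OF that]]] _
          rel_env_upd[OF "8.prems"(4) that]])
      (simp only: tr_ctx_upd envs_upd[OF "8.prems"(3) conjunct2[OF rel_D[OF that]]])
  \<comment> \<open>The bodies are monotone for the reversed orders too, and \<open>rel_dual\<close>
    lets \<open>step\<close> serve unchanged as the preservation hypothesis.\<close>
  have "rel (dual (hfa_frame g)) (dual (phfl_frame h)) T
      (least_fp (dual (hfa_frame g)) T (\<lambda>x. hfa_sem (hfa_frame g) a (\<rho>(X \<mapsto> x))))
      (least_fp (dual (phfl_frame h)) (tr_ty T) (\<lambda>y. phfl_sem M (phfl_frame h) (tr a) (\<eta>(X \<mapsto> y))))"
    by (rule rel_least_fp[OF po[THEN po_frame.po_frame_dual]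
          complete_type_dual[OF complete_type_hfa[OF F 8(1) h(1)]]
          complete_type_dual[OF complete_type_phfl[OF G h(3)]]
          conjunct2[OF lub_closed[OF F G 8(1) h(1,2)]]])
      (use "8.prems"(2,3) step in \<open>auto intro: F.mono_sem_upd_in[OF a(1)]
        F.mono_sem_upd_mono[OF a(1)] G.mono_sem_upd_in[OF a(2)] G.mono_sem_upd_mono[OF a(2)]\<close>)
  then show ?case by (simp add: greatest_fp_dual)
qed

theorem theorem4p8:
  fixes \<Gamma> :: "hbase ctx" and \<psi> :: hfa and A :: "hbase sty"
    and g :: "'c \<Rightarrow> ((hgnd, 'c) val \<rightharpoonup> (hgnd, 'c) val)"
    and h :: "'d \<Rightarrow> ((state \<Rightarrow> real, 'd) val \<rightharpoonup> (state \<Rightarrow> real, 'd) val)"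
    and \<rho> :: "(hgnd, 'c) env" and \<eta> :: "(state \<Rightarrow> real, 'd) env"
  assumes "\<forall>B\<in>ran \<Gamma>. is_A B"
    and "hfa_typed \<Gamma> \<psi> A"
    and "full_for (hfa_frame g) (derivation_types \<psi> \<Gamma>)"
    and "full_for (phfl_frame h) (tr_ty ` derivation_types \<psi> \<Gamma>)"
    and "\<rho> \<in> envs (hfa_frame g) \<Gamma>"
    and "\<eta> \<in> envs (phfl_frame h) (tr_ctx \<Gamma>)"
    and "rel_env (hfa_frame g) (phfl_frame h) \<Gamma> \<rho> \<eta>"
  shows "rel (hfa_frame g) (phfl_frame h) A
           (hfa_sem (hfa_frame g) \<psi> \<rho>)
           (phfl_sem M (phfl_frame h) (tr \<psi>) \<eta>)"
proof -
  obtain k where k: "full k (hfa_frame g)" "\<forall>B\<in>derivation_types \<psi> \<Gamma>. height B \<le> k"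
    using assms(3) by (auto simp: full_for_def)
  \<comment> \<open>The fullness hypothesis speaks of translated types; \<open>height_tr_ty\<close>
    turns its bound into one on the arithmetic types.\<close>
  obtain l where l: "full l (phfl_frame h)" "\<forall>B\<in>derivation_types \<psi> \<Gamma>. height B \<le> l"
    using assms(4) by (auto simp: full_for_def height_tr_ty)
  show ?thesis using fundamental_property[OF k(1) l(1) assms(2)] k(2) l(2) assms(5-7) by blast
qed

end
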